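(* Let $\mu$ be a measure and $\mathcal K$ a positive (kernel) operator that is bounded, positive semi-definite and self-adjoint on $L^2(\mu)$, and bounded on $L^\infty(\mu)$. Let $U>0$ solve the Sinkhorn problem $U\cdot\mathcal K[U]\equiv1$, and let $U^{(n)}$ be the $n$th iterate of the accelerated symmetric Sinkhorn algorithm $$U^{(n)}_a=1/\mathcal K[U^{(n)}],\qquad U^{(n)}_b=1/\mathcal K[U^{(n)}_a],\qquad U^{(n+1)}=\sqrt{U^{(n)}_aU^{(n)}_b},$$ with initial condition $U^{(0)}>0$. Then: (a) (Global convergence) For all $n\ge0$ and $U^{(0)}>0$, $$\|\log U^{(n)}-\log U\|_{L^\infty(\mu)}\le2\Big(\theta\,\tfrac{1+\theta}{2}\Big)^n\|\log U^{(0)}-\log U\|_{L^\infty(\mu)},$$ where $\theta<1$ is the worst-case contraction rate of standard Sinkhorn iteration (defined in the context). (b) (Local convergence rate) If $\|\log U^{(0)}-\log U\|_{L^\infty(\mu)}\le k<0.1$ and $k'':=ke^{4k}(2+\tfrac12ke^{4k})<\tfrac38$, then for all $n\geq 0$ $$\|\log U^{(n)}-\log U\|_{L^2(\mu)}\le(\tfrac18+k'')^n\,\|\log U^{(0)}-\log U\|_{L^2(\mu)}.$$ (c) (Stopping condition) Under the conditions of part (b), for all $n\ge1$, $$\|\log U^{(n)}-\log U\|_{L^2(\mu)}\le\big((\tfrac18+k'')^{-1}-1\big)^{-1}\|\log U^{(n)}-\log U^{(n-1)}\|_{L^2(\mu)}.$$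
   Context: Positive functions on $\operatorname{supp}\mu$ carry the projective Hilbert metric $d_{\Lambda^+}(\phi,\psi)=\sup\log\tfrac{\phi}{\psi}-\inf\log\tfrac{\phi}{\psi}$. The contraction rate is $$\theta:=\tanh\Big(\tfrac14\sup_{x,y\in\operatorname{supp}\mu}d_{\Lambda^+}(\mathcal K\delta_x,\mathcal K\delta_y)\Big),$$ assumed to satisfy $\theta<1$, where $\delta_x$ is the unit point mass at $x$, so that $\mathcal K\delta_x$ is the kernel of $\mathcal K$ with second argument $x$. *)

theory Defs
  imports "HOL-Analysis.Analysis" "HOL-Probability.Essential_Supremum"
begin

text \<open>Norms take values in \<open>[0, \<infinity>]\<close>; a measurable function lies in the
  corresponding space iff its norm is finite, and non-measurable functions have norm \<open>\<infinity>\<close>.\<close>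

definition Linf_norm :: "'a measure \<Rightarrow> ('a \<Rightarrow> real) \<Rightarrow> ennreal" where
  "Linf_norm M f =
     (if f \<in> borel_measurable M then esssup M (\<lambda>x. ennreal \<bar>f x\<bar>) else \<infinity>)"

definition L2_norm :: "'a measure \<Rightarrow> ('a \<Rightarrow> real) \<Rightarrow> ennreal" where
  "L2_norm M f =
     (if f \<in> borel_measurable M \<and> integrable M (\<lambda>x. (f x)\<^sup>2)
      then ennreal (sqrt (\<integral>x. (f x)\<^sup>2 \<partial>M)) else \<infinity>)"

definition measure_support :: "'a::topological_space measure \<Rightarrow> 'a set" where
  "measure_support M = {x. \<forall>V. open V \<longrightarrow> x \<in> V \<longrightarrow> emeasure M V > 0}"

definition kernel_op :: "'a measure \<Rightarrow> ('a \<Rightarrow> 'a \<Rightarrow> real) \<Rightarrow> ('a \<Rightarrow> real) \<Rightarrow> 'a \<Rightarrow> real" where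
  "kernel_op M \<kappa> f x = (\<integral>y. \<kappa> x y * f y \<partial>M)"

text \<open>The Bochner integral is 0 on non-integrable functions, so convergence of the integral
  defining \<open>kernel_op M \<kappa> f x\<close> has to be requested separately.\<close>

definition kernel_op_defined :: "'a measure \<Rightarrow> ('a \<Rightarrow> 'a \<Rightarrow> real) \<Rightarrow> ('a \<Rightarrow> real) \<Rightarrow> bool" where
  "kernel_op_defined M \<kappa> f \<longleftrightarrow> (AE x in M. integrable M (\<lambda>y. \<kappa> x y * f y))"

definition kernel_op_bounded ::
  "'a measure \<Rightarrow> (('a \<Rightarrow> real) \<Rightarrow> ennreal) \<Rightarrow> ('a \<Rightarrow> 'a \<Rightarrow> real) \<Rightarrow> bool" where
  "kernel_op_bounded M N \<kappa> \<longleftrightarrow>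
     (\<exists>C::real. \<forall>f. N f < \<infinity> \<longrightarrow>
        kernel_op_defined M \<kappa> f \<and> N (kernel_op M \<kappa> f) \<le> ennreal C * N f)"

definition kernel_op_self_adjoint :: "'a measure \<Rightarrow> ('a \<Rightarrow> 'a \<Rightarrow> real) \<Rightarrow> bool" where
  "kernel_op_self_adjoint M \<kappa> \<longleftrightarrow>
     (\<forall>f g. L2_norm M f < \<infinity> \<longrightarrow> L2_norm M g < \<infinity> \<longrightarrow>
        (\<integral>x. kernel_op M \<kappa> f x * g x \<partial>M) = (\<integral>x. f x * kernel_op M \<kappa> g x \<partial>M))"

definition kernel_op_pos_semidef :: "'a measure \<Rightarrow> ('a \<Rightarrow> 'a \<Rightarrow> real) \<Rightarrow> bool" where
  "kernel_op_pos_semidef M \<kappa> \<longleftrightarrow>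
     (\<forall>f. L2_norm M f < \<infinity> \<longrightarrow> 0 \<le> (\<integral>x. f x * kernel_op M \<kappa> f x \<partial>M))"

definition hilbert_metric :: "'a set \<Rightarrow> ('a \<Rightarrow> real) \<Rightarrow> ('a \<Rightarrow> real) \<Rightarrow> ereal" where
  "hilbert_metric S \<phi> \<psi> =
     (SUP z\<in>S. ereal (ln (\<phi> z / \<psi> z))) - (INF z\<in>S. ereal (ln (\<phi> z / \<psi> z)))"

text \<open>The continuous extension of \<open>tanh\<close>, with \<open>tanh \<infinity> = 1\<close>.\<close>

definition tanh_ereal :: "ereal \<Rightarrow> real" where
  "tanh_ereal t = (if t = \<infinity> then 1 else if t = -\<infinity> then -1 else tanh (real_of_ereal t))"

text \<open>Applying the operator to the point mass at \<open>x\<close> gives the function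
  \<open>\<lambda>z. \<kappa> z x\<close>. An infinite projective diameter gives rate 1.\<close>

definition contraction_rate ::
  "'a::topological_space measure \<Rightarrow> ('a \<Rightarrow> 'a \<Rightarrow> real) \<Rightarrow> real" where
  "contraction_rate M \<kappa> =
     tanh_ereal ((SUP x\<in>measure_support M. SUP y\<in>measure_support M.
        hilbert_metric (measure_support M) (\<lambda>z. \<kappa> z x) (\<lambda>z. \<kappa> z y)) / 4)"

definition sinkhorn_step ::
  "'a measure \<Rightarrow> ('a \<Rightarrow> 'a \<Rightarrow> real) \<Rightarrow> ('a \<Rightarrow> real) \<Rightarrow> 'a \<Rightarrow> real" where
  "sinkhorn_step M \<kappa> V = (\<lambda>x. 1 / kernel_op M \<kappa> V x)"

primrec accel_sinkhorn ::
  "'a measure \<Rightarrow> ('a \<Rightarrow> 'a \<Rightarrow> real) \<Rightarrow> ('a \<Rightarrow> real) \<Rightarrow> nat \<Rightarrow> 'a \<Rightarrow> real" where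
  "accel_sinkhorn M \<kappa> U0 0 = U0"
| "accel_sinkhorn M \<kappa> U0 (Suc n) =
     (let Ua = sinkhorn_step M \<kappa> (accel_sinkhorn M \<kappa> U0 n);
          Ub = sinkhorn_step M \<kappa> Ua
      in (\<lambda>x. sqrt (Ua x * Ub x)))"

definition log_diff :: "('a \<Rightarrow> real) \<Rightarrow> ('a \<Rightarrow> real) \<Rightarrow> 'a \<Rightarrow> real" where
  "log_diff V W = (\<lambda>x. ln (V x) - ln (W x))"

end

theory Submission
  imports Defs
begin

text \<open>
  Why the theorem holds.  Write an iterate as \<open>V = U e\<^sup>f\<close>.  Since \<open>U \<cdot> K[U] = 1\<close>, the operator
  \<open>P g = U \<cdot> K[U g]\<close> averages: \<open>P 1 = 1\<close>.  The Sinkhorn step \<open>V \<mapsto> 1 / K[V]\<close> becomes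
  \<open>f \<mapsto> - ln (P e\<^sup>f)\<close>, and an accelerated step is the mean of one such step and two such steps.
  Everything about the iteration is therefore a statement about \<open>P\<close>, which is symmetric and
  positive semi-definite because \<open>K\<close> is.

  The hypothesis \<open>\<theta> < 1\<close> says that all cross ratios of the kernel are at most \<open>e\<^sup>D\<close> with
  \<open>\<theta> = tanh (D / 4)\<close>.  It makes \<open>\<kappa> x y\<close> comparable with a product \<open>\<alpha> x \<cdot> \<beta> y\<close>, and together
  with the solvability of the Sinkhorn problem and self-adjointness this forces the measure to be
  finite (\<open>finite_space\<close>).  So \<open>P\<close> preserves the integral of bounded functions.

  Part (a).  By Birkhoff's theorem (\<open>birkhoff_two_densities\<close>) a Sinkhorn step multiplies the
  oscillation \<open>sup f - inf f\<close> by at most \<open>\<theta>\<close>, so an accelerated step multiplies it by at most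
  \<open>(\<theta> + \<theta>\<^sup>2) / 2\<close>.  The initial oscillation is at most twice the sup norm.  Conversely the sup norm
  of an iterate after at least one step is at most its oscillation, because the range of
  \<open>ln (V / U)\<close> meets 0: otherwise \<open>a\<close> and \<open>P a\<close> would have different integrals for
  \<open>a = 1 / P e\<^sup>f\<close> (\<open>accel_range_meets_zero\<close>).  If the initial sup norm is infinite the bound
  is vacuous, except when \<open>\<theta> = 0\<close>; then the kernel has rank one and one step reaches the solution.

  Parts (b) and (c).  To first order an accelerated step is \<open>f \<mapsto> (P\<^sup>2 f - P f) / 2\<close>.  The spectrum of
  \<open>P\<close> lies in \<open>[0, 1]\<close>, where \<open>t - t\<^sup>2 \<le> 1/4\<close>, so this linear map has norm at most \<open>1/8\<close>; a polynomial
  identity replaces the spectral theorem (\<open>P_minus_square_bound\<close>).  The remainder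
  \<open>ln (P e\<^sup>f) - P f\<close> lies between 0 and a small multiple of \<open>P \<bar>f\<bar>\<close> (\<open>log_mean_exp_remainder\<close>), and
  the sup norm never grows, so the estimate can be iterated.  Part (c) is the triangle inequality
  applied to one step of (b).
\<close>

section \<open>Contraction of averages for the Hilbert metric\<close>

text \<open>The left-hand side is the largest ratio of averages attainable when the two densities have cross
  ratio \<open>e\<^sup>D\<close> and the averaged function has two values with quotient \<open>e\<^sup>\<delta>\<close>.  After taking logarithms
  both sides vanish at \<open>\<delta> = 0\<close>, and the derivative of their difference has a sign because
  \<open>h (1 - e)\<^sup>2 \<ge> 0\<close> for \<open>h = e\<^sup>D\<^sup>/\<^sup>2\<close> and \<open>e = e\<^sup>\<delta>\<^sup>/\<^sup>2\<close>.\<close>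

lemma birkhoff_scalar_rate:
  fixes D \<delta> :: real
  assumes "0 \<le> D" "0 \<le> \<delta>"
  shows "((1 + exp (D/2) * exp (\<delta>/2)) / (exp (D/2) + exp (\<delta>/2)))\<^sup>2 \<le> exp (tanh (D/4) * \<delta>)"
proof -
  define h where "h = exp (D/2)"
  have h: "h \<ge> 1" "h > 0" using assms by (auto simp: h_def)
  have th: "tanh (D/4) = (h - 1) / (h + 1)"
  proof -
    have *: "exp (- 2 * (D/4)) = 1 / h" by (simp add: h_def exp_minus field_simps)
    have "1 - 1 / h = (h - 1) / h" "1 + 1 / h = (h + 1) / h" using h by (auto simp: field_simps)
    then have "(1 - 1 / h) / (1 + 1 / h) = (h - 1) / (h + 1)" using h by simp
    then show ?thesis using tanh_real_altdef[of "D/4"] unfolding * by metis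
  qed
  define \<phi> where "\<phi> t = tanh (D/4) * t - ln (1 + h * exp t) + ln (h + exp t)" for t
  have "\<phi> 0 \<le> \<phi> (\<delta>/2)"
  proof (rule DERIV_nonneg_imp_nondecreasing[where f = \<phi> and a = 0])
    fix t :: real
    define e where "e = exp t"
    have e: "e > 0" by (simp add: e_def)
    have "(\<phi> has_real_derivative (tanh (D/4) - h * e / (1 + h * e) + e / (h + e))) (at t)"
      unfolding \<phi>_def e_def using h
      by (auto intro!: derivative_eq_intros simp: add_pos_pos)
    moreover have "tanh (D/4) - h * e / (1 + h * e) + e / (h + e) \<ge> 0"
    proof -
      have "h * e / (1 + h * e) - e / (h + e) = e * (h - 1) * (h + 1) / ((1 + h*e) * (h + e))"
      proof -
        have "1 + h * e \<noteq> 0" "h + e \<noteq> 0" using h e by (auto intro!: less_imp_neq[symmetric] add_pos_pos)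
        then show ?thesis by (simp add: divide_simps) (simp add: algebra_simps)
      qed
      also have "\<dots> \<le> (h - 1) / (h + 1)"
      proof -
        have "e * (h + 1) * (h + 1) \<le> (1 + h*e) * (h + e)"
        proof -
          have "(1 + h*e) * (h + e) - e * (h + 1) * (h + 1) = h * (1 - e)\<^sup>2"
            by (simp add: power2_eq_square algebra_simps)
          moreover have "h * (1 - e)\<^sup>2 \<ge> 0" using h by simp
          ultimately show ?thesis by linarith
        qed
        then have "(h - 1) * (e * (h + 1) * (h + 1)) \<le> (h - 1) * ((1 + h*e) * (h + e))"
          using h by (intro mult_left_mono) auto
        moreover have "0 < (1 + h*e) * (h + e)" using h e by (simp add: add_pos_pos)
        ultimately show ?thesis using h by (simp add: divide_le_eq le_divide_eq mult_ac)
      qed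
      finally show ?thesis using th by simp
    qed
    ultimately show "\<exists>y. (\<phi> has_real_derivative y) (at t) \<and> 0 \<le> y" by blast
  qed (use assms(2) in simp)
  then have *: "2 * (ln (1 + h * exp (\<delta>/2)) - ln (h + exp (\<delta>/2))) \<le> tanh (D/4) * \<delta>"
    using h by (simp add: \<phi>_def add.commute)
  have pos: "(1 + h * exp (\<delta>/2)) / (h + exp (\<delta>/2)) > 0" using h by (simp add: add_pos_pos)
  have "((1 + h * exp (\<delta>/2)) / (h + exp (\<delta>/2)))\<^sup>2
      = exp (2 * ln ((1 + h * exp (\<delta>/2)) / (h + exp (\<delta>/2))))"
    using pos by (simp add: exp_double)
  also have "ln ((1 + h * exp (\<delta>/2)) / (h + exp (\<delta>/2))) = ln (1 + h * exp (\<delta>/2)) - ln (h + exp (\<delta>/2))"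
    using h by (subst ln_divide_pos) (auto simp: add_pos_pos)
  finally show ?thesis using * by (simp add: h_def)
qed

text \<open>Birkhoff's contraction inequality for a two-valued function: \<open>a\<close> and \<open>b\<close> are the probabilities of
  the larger value under the two densities.  With \<open>h = e\<^sup>D\<^sup>/\<^sup>2\<close> and \<open>e = e\<^sup>\<delta>\<^sup>/\<^sup>2\<close>, for fixed \<open>b\<close> the worst \<open>a\<close>
  is \<open>h\<^sup>2 b / (1 - b + h\<^sup>2 b)\<close>, and then the worst \<open>b\<close> is the zero of \<open>1 - b - h e b\<close>; in the proof the gap
  appears as a nonnegative multiple of the square of that expression.\<close>

lemma birkhoff_scalar:
  fixes a b D \<delta> :: real
  assumes D: "0 \<le> D" and \<delta>: "0 \<le> \<delta>" and a: "0 \<le> a" "a \<le> 1" and b: "0 \<le> b" "b \<le> 1"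
    and cross: "a * (1 - b) \<le> exp D * (b * (1 - a))"
  shows "1 + a * (exp \<delta> - 1) \<le> exp (tanh (D/4) * \<delta>) * (1 + b * (exp \<delta> - 1))"
proof -
  define h where "h = exp (D/2)"
  define e where "e = exp (\<delta>/2)"
  have he: "h \<ge> 1" "e \<ge> 1" using D \<delta> by (auto simp: h_def e_def)
  have sq: "exp D = h\<^sup>2" "exp \<delta> = e\<^sup>2" by (simp_all add: h_def e_def flip: exp_double)
  \<comment> \<open>the denominator of the worst \<open>a\<close>\<close>
  define w where "w = 1 - b + h\<^sup>2 * b"
  have "b * 1 \<le> b * h\<^sup>2" using b he by (intro mult_left_mono) auto
  then have w: "w \<ge> 1" unfolding w_def by (simp add: algebra_simps)
  have aw: "a * w \<le> h\<^sup>2 * b" using cross unfolding w_def sq by (simp add: algebra_simps)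
  have e1: "e\<^sup>2 - 1 \<ge> 0" and h1: "h\<^sup>2 - 1 \<ge> 0" using he by auto
  have u: "1 + b * (e\<^sup>2 - 1) \<ge> 0" using b e1 by (intro add_nonneg_nonneg mult_nonneg_nonneg) auto
  have "w * (1 + a * (e\<^sup>2 - 1)) \<le> w + h\<^sup>2 * b * (e\<^sup>2 - 1)"
    using mult_right_mono[OF aw e1] by (simp add: algebra_simps)
  then have "(w * (1 + a * (e\<^sup>2 - 1))) * (h + e)\<^sup>2 \<le> (w + h\<^sup>2 * b * (e\<^sup>2 - 1)) * (h + e)\<^sup>2"
    by (rule mult_right_mono) simp
  also have "\<dots> \<le> (1 + h * e)\<^sup>2 * (w * (1 + b * (e\<^sup>2 - 1)))"
  proof -
    have "(1 + h * e)\<^sup>2 * (w * (1 + b * (e\<^sup>2 - 1))) - (w + h\<^sup>2 * b * (e\<^sup>2 - 1)) * (h + e)\<^sup>2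
       = (h\<^sup>2 - 1) * (e\<^sup>2 - 1) * (1 - b - h * e * b)\<^sup>2"
      unfolding w_def by algebra
    also have "\<dots> \<ge> 0" using e1 h1 by simp
    finally show ?thesis by simp
  qed
  finally have "w * ((1 + a * (e\<^sup>2 - 1)) * (h + e)\<^sup>2) \<le> w * ((1 + h * e)\<^sup>2 * (1 + b * (e\<^sup>2 - 1)))"
    by (simp add: mult_ac)
  then have "(1 + a * (e\<^sup>2 - 1)) * (h + e)\<^sup>2 \<le> (1 + h * e)\<^sup>2 * (1 + b * (e\<^sup>2 - 1))"
    using w by simp
  then have "1 + a * (e\<^sup>2 - 1) \<le> ((1 + h * e) / (h + e))\<^sup>2 * (1 + b * (e\<^sup>2 - 1))"
    using he by (simp add: power_divide field_simps)
  also have "\<dots> \<le> exp (tanh (D/4) * \<delta>) * (1 + b * (e\<^sup>2 - 1))"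
    using birkhoff_scalar_rate[OF D \<delta>] u unfolding h_def e_def by (intro mult_right_mono) auto
  finally show ?thesis by (simp add: sq)
qed

lemma integrable_times_bounded:
  fixes p g :: "'a \<Rightarrow> real"
  assumes p: "integrable M p" and g: "g \<in> borel_measurable M" "AE x in M. \<bar>g x\<bar> \<le> B"
  shows "integrable M (\<lambda>x. p x * g x)"
proof (rule Bochner_Integration.integrable_bound)
  show "integrable M (\<lambda>x. B * p x)" by (rule integrable_mult_right[OF p])
  show "(\<lambda>x. p x * g x) \<in> borel_measurable M"
    by (rule borel_measurable_times[OF borel_measurable_integrable[OF p] g(1)])
  show "AE x in M. norm (p x * g x) \<le> norm (B * p x)"
    using g(2)
  proof eventually_elim
    case (elim x)
    have "\<bar>g x\<bar> \<le> \<bar>B\<bar>" using elim by linarith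
    from mult_right_mono[OF this, of "\<bar>p x\<bar>"] show ?case by (simp add: abs_mult mult.commute)
  qed
qed

text \<open>The inequality is linear in \<open>g\<close>, so for a given pair of densities the worst \<open>g\<close> takes only its two
  extreme values, the larger one exactly on the set \<open>A\<close> where the difference of the two sides is
  increasing in \<open>g\<close>.  This reduces the claim to the probabilities \<open>a\<close>, \<open>b\<close> of \<open>A\<close>; the cross-ratio
  hypothesis, integrated over \<open>A\<close> and its complement, is the hypothesis of \<open>birkhoff_scalar\<close>.\<close>

lemma birkhoff_two_densities:
  fixes p q g :: "'a \<Rightarrow> real"
  assumes D: "0 \<le> D" and \<delta>: "0 \<le> \<delta>" and m: "0 \<le> m"
    and p: "integrable M p" "AE x in M. 0 \<le> p x" "(\<integral>x. p x \<partial>M) = 1"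
    and q: "integrable M q" "AE x in M. 0 \<le> q x" "(\<integral>x. q x \<partial>M) = 1"
    and cross: "AE x in M. AE y in M. p x * q y \<le> exp D * (q x * p y)"
    and g: "g \<in> borel_measurable M" "AE x in M. m \<le> g x \<and> g x \<le> m * exp \<delta>"
  shows "(\<integral>x. p x * g x \<partial>M) \<le> exp (tanh (D/4) * \<delta>) * (\<integral>x. q x * g x \<partial>M)"
proof -
  define c where "c = exp (tanh (D/4) * \<delta>)"
  define A where "A = {x \<in> space M. c * q x < p x}"
  have [measurable]: "p \<in> borel_measurable M" "q \<in> borel_measurable M" "g \<in> borel_measurable M"
    using p q g by auto
  have A[measurable]: "A \<in> sets M" unfolding A_def by measurable
  have int[simp]: "integrable M (\<lambda>x. p x * indicator A x)" "integrable M (\<lambda>x. q x * indicator A x)"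
    using A integrable_mult_indicator[OF A p(1)] integrable_mult_indicator[OF A q(1)]
    by (simp_all add: mult.commute)
  define a where "a = (\<integral>x. p x * indicator A x \<partial>M)"
  define b where "b = (\<integral>x. q x * indicator A x \<partial>M)"
  have a0: "0 \<le> a" "0 \<le> b" unfolding a_def b_def using p q by (auto intro!: integral_nonneg_AE)
  have "a \<le> (\<integral>x. p x \<partial>M)" "b \<le> (\<integral>x. q x \<partial>M)"
    unfolding a_def b_def
    by (rule integral_mono_AE, use p q in simp, use p q in simp,
        rule AE_mp[OF p(2)] AE_mp[OF q(2)], simp add: indicator_def,
        rule integral_mono_AE, use p q in simp, use p q in simp,
        rule AE_mp[OF q(2)], simp add: indicator_def)
  then have a1: "a \<le> 1" "b \<le> 1" using p q by auto
  have compl: "(\<integral>y. p y * (1 - indicator A y) \<partial>M) = 1 - a" "(\<integral>y. q y * (1 - indicator A y) \<partial>M) = 1 - b"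
    unfolding a_def b_def using p q by (simp_all add: right_diff_distrib)
  have compl_int: "integrable M (\<lambda>y. p y * (1 - indicator A y))" "integrable M (\<lambda>y. q y * (1 - indicator A y))"
    using p q by (simp_all add: right_diff_distrib)
  have "AE x in M. p x * (1 - b) \<le> exp D * (q x * (1 - a))"
    using cross
  proof eventually_elim
    case (elim x)
    have "(\<integral>y. p x * (q y * (1 - indicator A y)) \<partial>M) \<le> (\<integral>y. (exp D * q x) * (p y * (1 - indicator A y)) \<partial>M)"
    proof (rule integral_mono_AE)
      show "AE y in M. p x * (q y * (1 - indicator A y)) \<le> exp D * q x * (p y * (1 - indicator A y))"
        using elim by eventually_elim (auto simp: indicator_def mult_ac)
    qed (use compl_int in auto)
    then show ?case using compl compl_int by (simp only: integral_mult_right_zero mult.assoc)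
  qed
  then have "(\<integral>x. (1 - b) * (p x * indicator A x) \<partial>M) \<le> (\<integral>x. (exp D * (1 - a)) * (q x * indicator A x) \<partial>M)"
    by (intro integral_mono_AE integrable_mult_right int) (auto simp: indicator_def mult_ac)
  then have "a * (1 - b) \<le> exp D * (b * (1 - a))"
    by (simp only: integral_mult_right_zero flip: a_def b_def) (simp add: mult_ac)
  from birkhoff_scalar[OF D \<delta> a0(1) a1(1) a0(2) a1(2) this]
  have key: "1 + a * (exp \<delta> - 1) \<le> c * (1 + b * (exp \<delta> - 1))" by (simp add: c_def)
  have bnd: "AE x in M. \<bar>g x\<bar> \<le> m * exp \<delta>" using g(2) by eventually_elim (use m in auto)
  have gi: "integrable M (\<lambda>x. p x * g x)" "integrable M (\<lambda>x. q x * g x)"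
    using integrable_times_bounded[OF p(1) g(1)] integrable_times_bounded[OF q(1) g(1)] bnd by auto
  \<comment> \<open>pointwise, the worst value of \<open>g\<close> depends on the sign of \<open>p - c q\<close> only\<close>
  have "(\<integral>x. p x * g x - c * (q x * g x) \<partial>M)
     \<le> (\<integral>x. m * (p x - c * q x + (exp \<delta> - 1) * (p x * indicator A x - c * (q x * indicator A x))) \<partial>M)"
  proof (rule integral_mono_AE)
    show "AE x in M. p x * g x - c * (q x * g x)
      \<le> m * (p x - c * q x + (exp \<delta> - 1) * (p x * indicator A x - c * (q x * indicator A x)))"
      using g(2) AE_space
    proof eventually_elim
      case (elim x)
      show ?case
      proof (cases "x \<in> A")
        case True
        then have "(p x - c * q x) * g x \<le> (p x - c * q x) * (m * exp \<delta>)"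
          using elim by (intro mult_left_mono) (auto simp: A_def)
        then show ?thesis using True by (simp add: algebra_simps)
      next
        case False
        then have "(p x - c * q x) * g x \<le> (p x - c * q x) * m"
          using elim by (intro mult_left_mono_neg) (auto simp: A_def)
        then show ?thesis using False by (simp add: algebra_simps)
      qed
    qed
  qed (use p(1) q(1) gi in auto)
  also have "\<dots> = m * ((1 + a * (exp \<delta> - 1)) - c * (1 + b * (exp \<delta> - 1)))"
    using p q by (simp add: algebra_simps flip: a_def b_def)
  also have "\<dots> \<le> 0" using key m by (intro mult_nonneg_nonpos) auto
  finally show ?thesis using gi by (simp add: c_def)
qed

section \<open>The linear theory of a symmetric Markov operator\<close>

text \<open>Every row \<open>p x\<close> is a probability density, also for \<open>x\<close> in a null set, so that the averages below obey
  pointwise rules without exceptional points.  Symmetry and positivity are properties of the operator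
  and hold only in the integrated sense.\<close>

locale symmetric_markov = finite_measure M for M :: "'a measure" +
  fixes p :: "'a \<Rightarrow> 'a \<Rightarrow> real"
  assumes p_measurable[measurable]: "(\<lambda>(x, y). p x y) \<in> borel_measurable (M \<Otimes>\<^sub>M M)"
    and p_integrable: "integrable M (p x)"
    and p_nonneg: "AE y in M. 0 \<le> p x y"
    and p_total: "(\<integral>y. p x y \<partial>M) = 1"
    and p_symmetric: "\<lbrakk>f \<in> borel_measurable M; g \<in> borel_measurable M;
        AE x in M. 0 \<le> f x \<and> f x \<le> B; AE x in M. 0 \<le> g x \<and> g x \<le> B\<rbrakk> \<Longrightarrow>
        (\<integral>x. f x * (\<integral>y. p x y * g y \<partial>M) \<partial>M) = (\<integral>x. (\<integral>y. p x y * f y \<partial>M) * g x \<partial>M)"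
    and p_psd: "\<lbrakk>f \<in> borel_measurable M; AE x in M. \<bar>f x\<bar> \<le> B\<rbrakk> \<Longrightarrow>
        0 \<le> (\<integral>x. f x * (\<integral>y. p x y * f y \<partial>M) \<partial>M)"
begin

text \<open>On the essentially bounded functions all products are integrable, the measure being finite.\<close>

definition bdd :: "('a \<Rightarrow> real) \<Rightarrow> bool" where
  "bdd f \<longleftrightarrow> f \<in> borel_measurable M \<and> (\<exists>B. AE x in M. \<bar>f x\<bar> \<le> B)"

definition P :: "('a \<Rightarrow> real) \<Rightarrow> 'a \<Rightarrow> real" where
  "P f x = (\<integral>y. p x y * f y \<partial>M)"

definition ip :: "('a \<Rightarrow> real) \<Rightarrow> ('a \<Rightarrow> real) \<Rightarrow> real" where
  "ip f g = (\<integral>x. f x * g x \<partial>M)"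

definition nrm :: "('a \<Rightarrow> real) \<Rightarrow> real" where
  "nrm f = sqrt (ip f f)"

lemma bdd_measurable[measurable_dest]: "bdd f \<Longrightarrow> f \<in> borel_measurable M"
  by (simp add: bdd_def)

lemma bddI: "f \<in> borel_measurable M \<Longrightarrow> AE x in M. \<bar>f x\<bar> \<le> B \<Longrightarrow> bdd f"
  by (auto simp: bdd_def)

lemma bdd_const[simp]: "bdd (\<lambda>x. c)"
  by (rule bddI[of _ "\<bar>c\<bar>"]) auto

lemma bdd_add[simp]:
  assumes "bdd f" "bdd g" shows "bdd (\<lambda>x. f x + g x)"
proof -
  obtain B C where "AE x in M. \<bar>f x\<bar> \<le> B" "AE x in M. \<bar>g x\<bar> \<le> C" using assms by (auto simp: bdd_def)
  then have "AE x in M. \<bar>f x + g x\<bar> \<le> B + C" by eventually_elim auto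
  with assms show ?thesis by (intro bddI[where B="B+C"]) (auto simp: bdd_def)
qed

lemma bdd_mult[simp]:
  assumes "bdd f" "bdd g" shows "bdd (\<lambda>x. f x * g x)"
proof -
  obtain B C where "AE x in M. \<bar>f x\<bar> \<le> B" "AE x in M. \<bar>g x\<bar> \<le> C" using assms by (auto simp: bdd_def)
  then have "AE x in M. \<bar>f x * g x\<bar> \<le> B * C"
    by eventually_elim (auto simp: abs_mult intro!: mult_mono order_trans[OF abs_ge_zero])
  with assms show ?thesis by (intro bddI[where B="B*C"]) (auto simp: bdd_def)
qed

lemma bdd_uminus[simp]: "bdd f \<Longrightarrow> bdd (\<lambda>x. - f x)"
  using bdd_mult[of "\<lambda>_. -1" f] by simp

lemma bdd_diff[simp]: "bdd f \<Longrightarrow> bdd g \<Longrightarrow> bdd (\<lambda>x. f x - g x)"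
  using bdd_add[of f "\<lambda>x. - g x"] by simp

lemma bdd_divide[simp]: "bdd f \<Longrightarrow> bdd (\<lambda>x. f x / c)"
  using bdd_mult[of f "\<lambda>_. inverse c"] by (simp add: divide_inverse)

lemma bdd_abs[simp]: "bdd f \<Longrightarrow> bdd (\<lambda>x. \<bar>f x\<bar>)"
  by (auto simp: bdd_def)

lemma bdd_exp[simp]:
  assumes "bdd f" shows "bdd (\<lambda>x. exp (f x))"
proof -
  obtain B where "AE x in M. \<bar>f x\<bar> \<le> B" using assms by (auto simp: bdd_def)
  then have "AE x in M. \<bar>exp (f x)\<bar> \<le> exp B" by eventually_elim auto
  with assms show ?thesis by (intro bddI[where B="exp B"]) (auto simp: bdd_def)
qed

lemma bdd_integrable[simp]: assumes "bdd f" shows "integrable M f"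
  using assms by (auto simp: bdd_def intro!: integrable_const_bound)

lemma P_integrable: "bdd f \<Longrightarrow> integrable M (\<lambda>y. p x y * f y)"
  unfolding bdd_def using integrable_times_bounded[OF p_integrable] by blast

lemma P_add: "bdd f \<Longrightarrow> bdd g \<Longrightarrow> P (\<lambda>x. f x + g x) = (\<lambda>x. P f x + P g x)"
  by (rule ext) (simp only: P_def distrib_left, intro Bochner_Integration.integral_add P_integrable)

lemma P_diff: "bdd f \<Longrightarrow> bdd g \<Longrightarrow> P (\<lambda>x. f x - g x) = (\<lambda>x. P f x - P g x)"
  by (rule ext) (simp only: P_def right_diff_distrib, intro Bochner_Integration.integral_diff P_integrable)

lemma P_cmult: "P (\<lambda>x. c * f x) = (\<lambda>x. c * P f x)"
  by (simp add: fun_eq_iff P_def mult.left_commute)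

lemma P_divide: "P (\<lambda>x. f x / c) = (\<lambda>x. P f x / c)"
  by (simp add: fun_eq_iff P_def)

lemma P_const: "P (\<lambda>_. c) = (\<lambda>_. c)"
  by (simp add: fun_eq_iff P_def p_total)

lemma P_mono:
  assumes "bdd f" "bdd g" "AE x in M. f x \<le> g x" shows "P f x \<le> P g x"
  unfolding P_def
proof (rule integral_mono_AE)
  show "AE y in M. p x y * f y \<le> p x y * g y"
    using assms(3) p_nonneg[of x] by eventually_elim (rule mult_left_mono)
qed (use assms in \<open>simp_all add: P_integrable\<close>)

lemma P_ge: "bdd f \<Longrightarrow> AE x in M. c \<le> f x \<Longrightarrow> c \<le> P f x"
  using P_mono[of "\<lambda>_. c" f x] by (simp add: P_const)

lemma P_le: "bdd f \<Longrightarrow> AE x in M. f x \<le> c \<Longrightarrow> P f x \<le> c"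
  using P_mono[of f "\<lambda>_. c" x] by (simp add: P_const)

lemma P_cong_AE: "bdd f \<Longrightarrow> bdd g \<Longrightarrow> AE x in M. f x = g x \<Longrightarrow> P f = P g"
  by (intro ext antisym P_mono) (auto elim: eventually_mono)

lemma P_measurable[measurable]:
  assumes [measurable]: "f \<in> borel_measurable M" shows "P f \<in> borel_measurable M"
  unfolding P_def by measurable

lemma P_abs_le:
  assumes "bdd f" "AE x in M. \<bar>f x\<bar> \<le> B" shows "\<bar>P f x\<bar> \<le> B"
proof -
  have "AE x in M. - B \<le> f x" "AE x in M. f x \<le> B"
    using assms(2) by (eventually_elim, linarith)+
  from P_ge[OF assms(1) this(1), of x] P_le[OF assms(1) this(2), of x] show ?thesis by linarith
qed

lemma bdd_P[simp]: assumes "bdd f" shows "bdd (P f)"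
proof -
  obtain B where "AE x in M. \<bar>f x\<bar> \<le> B" using assms by (auto simp: bdd_def)
  from P_abs_le[OF assms this] show ?thesis using assms by (intro bddI[where B=B]) (auto simp: bdd_def)
qed

lemma ip_sym: "ip f g = ip g f" by (simp add: ip_def mult.commute)

lemma ip_diff_left: "bdd f \<Longrightarrow> bdd g \<Longrightarrow> bdd h \<Longrightarrow> ip (\<lambda>x. f x - g x) h = ip f h - ip g h"
  unfolding ip_def left_diff_distrib by (intro Bochner_Integration.integral_diff bdd_integrable bdd_mult)

lemma ip_diff_right: "bdd f \<Longrightarrow> bdd g \<Longrightarrow> bdd h \<Longrightarrow> ip h (\<lambda>x. f x - g x) = ip h f - ip h g"
  unfolding ip_def right_diff_distrib by (intro Bochner_Integration.integral_diff bdd_integrable bdd_mult)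

lemma ip_add_left: "bdd f \<Longrightarrow> bdd g \<Longrightarrow> bdd h \<Longrightarrow> ip (\<lambda>x. f x + g x) h = ip f h + ip g h"
  unfolding ip_def distrib_right by (intro Bochner_Integration.integral_add bdd_integrable bdd_mult)

lemma ip_add_right: "bdd f \<Longrightarrow> bdd g \<Longrightarrow> bdd h \<Longrightarrow> ip h (\<lambda>x. f x + g x) = ip h f + ip h g"
  unfolding ip_def distrib_left by (intro Bochner_Integration.integral_add bdd_integrable bdd_mult)

lemma ip_cmult: "ip (\<lambda>x. c * f x) g = c * ip f g" "ip f (\<lambda>x. c * g x) = c * ip f g"
  by (simp_all add: ip_def mult.assoc mult.left_commute)

lemma ip_divide: "ip (\<lambda>x. f x / c) g = ip f g / c" "ip f (\<lambda>x. g x / c) = ip f g / c"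
  by (simp_all add: ip_def)

lemmas ip_expand = ip_diff_left ip_diff_right ip_add_left ip_add_right ip_cmult ip_divide

lemma ip_nonneg: "0 \<le> ip f f"
  by (simp add: ip_def)

text \<open>Symmetry is assumed for nonnegative functions only; adding a constant to both arguments and
  expanding gives the general case.\<close>

lemma ip_P_sym:
  assumes "bdd f" "bdd g" shows "ip f (P g) = ip (P f) g"
proof -
  obtain B1 B2 where B: "AE x in M. \<bar>f x\<bar> \<le> B1" "AE x in M. \<bar>g x\<bar> \<le> B2"
    using assms by (auto simp: bdd_def)
  \<comment> \<open>large enough to make both \<open>f + B\<close> and \<open>g + B\<close> nonnegative\<close>
  define B where "B = max \<bar>B1\<bar> \<bar>B2\<bar>"
  have [simp]: "B \<ge> 0" by (simp add: B_def)
  have f: "AE x in M. 0 \<le> f x + B \<and> f x + B \<le> 2 * B" using B(1) by eventually_elim (auto simp: B_def)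
  have g: "AE x in M. 0 \<le> g x + B \<and> g x + B \<le> 2 * B" using B(2) by eventually_elim (auto simp: B_def)
  have c: "AE x in M. 0 \<le> B \<and> B \<le> 2 * B" by simp
  note [measurable] = bdd_measurable[OF assms(1)] bdd_measurable[OF assms(2)]
  have fg: "ip (\<lambda>x. f x + B) (P (\<lambda>x. g x + B)) = ip (P (\<lambda>x. f x + B)) (\<lambda>x. g x + B)"
    unfolding ip_def P_def by (rule p_symmetric[OF _ _ f g]) auto
  have fc: "ip (\<lambda>x. f x + B) (P (\<lambda>x. B)) = ip (P (\<lambda>x. f x + B)) (\<lambda>x. B)"
    unfolding ip_def P_def by (rule p_symmetric[OF _ _ f c]) auto
  have cg: "ip (\<lambda>x. B) (P (\<lambda>x. g x + B)) = ip (P (\<lambda>x. B)) (\<lambda>x. g x + B)"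
    unfolding ip_def P_def by (rule p_symmetric[OF _ _ c g]) auto
  show ?thesis using fg fc cg assms by (simp add: P_add P_const ip_expand)
qed

lemma integral_P:
  assumes "bdd f" shows "(\<integral>x. P f x \<partial>M) = (\<integral>x. f x \<partial>M)"
  using ip_P_sym[OF assms, of "\<lambda>_. 1"] by (simp add: ip_def P_const)

text \<open>Jensen's inequality for the square: the variance of \<open>f\<close> under the density \<open>p x\<close> is nonnegative.\<close>

lemma P_square_le:
  assumes "bdd f" shows "(P f x)\<^sup>2 \<le> P (\<lambda>y. f y * f y) x"
proof -
  define c where "c = P f x"
  have eq: "(\<lambda>y. (f y - c) * (f y - c)) = (\<lambda>y. f y * f y - 2 * c * f y + c * c)"
    by (simp add: algebra_simps)
  have "0 \<le> P (\<lambda>y. (f y - c) * (f y - c)) x"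
    using assms by (intro P_ge) auto
  also have "\<dots> = P (\<lambda>y. f y * f y) x - 2 * c * P f x + c * c"
    unfolding eq using assms by (simp add: P_add P_diff P_cmult P_const)
  finally show ?thesis by (simp add: c_def power2_eq_square)
qed

text \<open>Jensen's inequality integrated against the invariant measure.\<close>

lemma P_contraction:
  assumes "bdd f" shows "ip (P f) (P f) \<le> ip f f"
proof -
  have "ip (P f) (P f) \<le> (\<integral>x. P (\<lambda>y. f y * f y) x \<partial>M)"
    unfolding ip_def using assms P_square_le[OF assms]
    by (intro integral_mono) (auto simp: power2_eq_square)
  also have "\<dots> = ip f f" using assms by (simp add: integral_P ip_def)
  finally show ?thesis .
qed

lemma ip_P_nonneg: assumes "bdd f" shows "0 \<le> ip f (P f)"
  using assms p_psd[of f] by (auto simp: bdd_def ip_def P_def)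

lemma ip_P_le: assumes "bdd f" shows "ip f (P f) \<le> ip f f"
  using ip_nonneg[of "\<lambda>x. f x - P f x"] P_contraction[OF assms] assms ip_sym[of "P f" f]
  by (simp add: ip_expand)

text \<open>Normal forms for the numbers \<open>\<langle>f, P\<^sup>j f\<rangle>\<close> with \<open>j \<le> 4\<close>.\<close>

lemma ip_moments:
  assumes "bdd f"
  shows "ip (P f) f = ip f (P f)" "ip f (P (P f)) = ip (P f) (P f)"
    "ip (P (P f)) f = ip (P f) (P f)" "ip (P (P f)) (P f) = ip (P f) (P (P f))"
  using ip_P_sym[OF assms bdd_P[OF assms]] by (metis ip_sym)+

text \<open>From \<open>0 \<le> P \<le> 1\<close> and the identity \<open>P - P\<^sup>2 = (1 - P) P (1 - P) + P (1 - P) P\<close>.\<close>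

lemma P_minus_square_psd:
  assumes g: "bdd g" shows "ip (P g) (P g) \<le> ip g (P g)"
  using ip_P_nonneg[of "\<lambda>x. g x - P g x"] ip_P_le[of "P g"] g
  by (simp add: ip_expand P_diff ip_moments)

text \<open>A substitute for the spectral theorem.  With \<open>Q = P - P\<^sup>2\<close> and \<open>B = 1/2 - P\<close> one has
  \<open>1/16 - Q\<^sup>2 = B (1/4) B + B Q B\<close>, and both terms are positive semi-definite.\<close>

lemma P_minus_square_bound:
  assumes f: "bdd f"
  shows "ip (\<lambda>x. P f x - P (P f) x) (\<lambda>x. P f x - P (P f) x) \<le> ip f f / 16"
proof -
  define g where "g = (\<lambda>x. f x / 2 - P f x)"
  have g: "bdd g" using f by (simp add: g_def)
  have Pg: "P g = (\<lambda>x. P f x / 2 - P (P f) x)" using f by (simp add: g_def P_diff P_divide)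
  note sym = ip_moments[OF f]
  have "ip g g = ip f f / 4 - ip f (P f) + ip (P f) (P f)"
    using f unfolding g_def by (simp add: ip_expand sym field_simps)
  moreover have "ip g (P g) = ip f (P f) / 4 - ip (P f) (P f) + ip (P f) (P (P f))"
    using f unfolding Pg unfolding g_def by (simp add: ip_expand sym field_simps)
  moreover have "ip (P g) (P g) = ip (P f) (P f) / 4 - ip (P f) (P (P f)) + ip (P (P f)) (P (P f))"
    using f unfolding Pg by (simp add: ip_expand sym field_simps)
  moreover have "ip (\<lambda>x. P f x - P (P f) x) (\<lambda>x. P f x - P (P f) x)
      = ip (P f) (P f) - 2 * ip (P f) (P (P f)) + ip (P (P f)) (P (P f))"
    using f by (simp add: ip_expand sym)
  ultimately show ?thesis using P_minus_square_psd[OF g] ip_nonneg[of g] by linarith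
qed

end

section \<open>The accelerated step in logarithmic coordinates\<close>

text \<open>Linear in \<open>\<bar>t\<bar>\<close> on purpose: one factor of \<open>t\<^sup>2\<close> is spent on the sup norm, the other is kept for the
  \<open>L\<^sup>2\<close> norm.\<close>

lemma exp_quadratic_remainder:
  fixes t k :: real
  assumes "\<bar>t\<bar> \<le> k" shows "exp t - 1 - t \<le> k * exp k / 2 * \<bar>t\<bar>"
proof -
  obtain s where s: "\<bar>s\<bar> \<le> \<bar>t\<bar>" "exp t = (\<Sum>m<2. t ^ m / fact m) + exp s / fact 2 * t ^ 2"
    using Maclaurin_exp_le[of t 2] by auto
  have "exp t - 1 - t = exp s / 2 * (\<bar>t\<bar> * \<bar>t\<bar>)"
    using s(2) by (simp add: numeral_2_eq_2 power2_eq_square)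
  also have "\<dots> \<le> exp k / 2 * (k * \<bar>t\<bar>)"
    using s(1) assms by (intro mult_mono) auto
  finally show ?thesis by (simp add: mult_ac)
qed

context symmetric_markov
begin

lemma nrm_nonneg[simp]: "0 \<le> nrm f" by (simp add: nrm_def ip_nonneg)

lemma nrm_square: "nrm f * nrm f = ip f f" by (simp add: nrm_def ip_nonneg)

lemma nrm_mono_AE:
  assumes "bdd f" "bdd g" "AE x in M. \<bar>f x\<bar> \<le> \<bar>g x\<bar>" shows "nrm f \<le> nrm g"
  unfolding nrm_def ip_def
proof (rule real_sqrt_le_mono, rule integral_mono_AE)
  show "AE x in M. f x * f x \<le> g x * g x"
    using assms(3) by eventually_elim (metis abs_le_square_iff power2_eq_square)
qed (use assms in simp_all)

lemma nrm_cmult: "nrm (\<lambda>x. c * f x) = \<bar>c\<bar> * nrm f"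
  by (simp add: nrm_def ip_cmult real_sqrt_mult flip: mult.assoc)

lemma ip_Cauchy_Schwarz:
  assumes f: "bdd f" and g: "bdd g" shows "ip f g \<le> nrm f * nrm g"
proof (cases "nrm f = 0 \<or> nrm g = 0")
  case True
  then have "(AE x in M. f x * f x = 0) \<or> (AE x in M. g x * g x = 0)"
    using integral_nonneg_eq_0_iff_AE[of M "\<lambda>x. f x * f x"] integral_nonneg_eq_0_iff_AE[of M "\<lambda>x. g x * g x"] f g
    by (auto simp: nrm_def ip_def)
  then have "AE x in M. f x * g x = 0" by (auto elim: eventually_mono)
  then have "ip f g = 0" unfolding ip_def by (rule integral_eq_zero_AE)
  then show ?thesis by simp
next
  case False
  then have pos: "nrm f > 0" "nrm g > 0" using nrm_nonneg[of f] nrm_nonneg[of g] by linarith+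
  have "0 \<le> ip (\<lambda>x. nrm g * f x - nrm f * g x) (\<lambda>x. nrm g * f x - nrm f * g x)" by (rule ip_nonneg)
  also have "\<dots> = nrm g * (nrm g * ip f f) + nrm f * (nrm f * ip g g) - 2 * (nrm f * nrm g) * ip f g"
    using f g by (simp add: ip_expand ip_sym[of g f]) (simp add: algebra_simps)
  also have "\<dots> = 2 * (nrm f * nrm g) * (nrm f * nrm g - ip f g)"
    unfolding nrm_square[symmetric] by (simp add: algebra_simps)
  finally have "0 \<le> nrm f * nrm g - ip f g"
    using pos mult_pos_pos[OF pos] by (subst (asm) zero_le_mult_iff) linarith
  then show ?thesis by simp
qed

lemma nrm_triangle:
  assumes f: "bdd f" and g: "bdd g" shows "nrm (\<lambda>x. f x + g x) \<le> nrm f + nrm g"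
proof (rule power2_le_imp_le)
  have "(nrm (\<lambda>x. f x + g x))\<^sup>2 = ip f f + 2 * ip f g + ip g g"
    using f g by (simp add: power2_eq_square nrm_square ip_expand ip_sym[of g f])
  also have "\<dots> \<le> (nrm f + nrm g)\<^sup>2"
    using ip_Cauchy_Schwarz[OF f g] unfolding nrm_square[symmetric]
    by (simp add: power2_eq_square algebra_simps)
  finally show "(nrm (\<lambda>x. f x + g x))\<^sup>2 \<le> (nrm f + nrm g)\<^sup>2" .
qed simp

lemma nrm_triangle_diff:
  assumes f: "bdd f" and g: "bdd g" shows "nrm (\<lambda>x. f x - g x) \<le> nrm f + nrm g"
  using nrm_triangle[OF f bdd_uminus[OF g]] nrm_cmult[of "-1" g] by simp

lemma nrm_P: "bdd f \<Longrightarrow> nrm (P f) \<le> nrm f"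
  unfolding nrm_def by (rule real_sqrt_le_mono) (rule P_contraction)

lemma nrm_P_minus_square:
  assumes "bdd f" shows "nrm (\<lambda>x. P f x - P (P f) x) \<le> nrm f / 4"
proof -
  have "sqrt (ip f f / 16) = nrm f / 4" by (simp add: nrm_def real_sqrt_divide)
  then show ?thesis using real_sqrt_le_mono[OF P_minus_square_bound[OF assms]] unfolding nrm_def by metis
qed

text \<open>The Sinkhorn step acting on \<open>f = ln (V / U)\<close>.\<close>

definition log_step :: "('a \<Rightarrow> real) \<Rightarrow> 'a \<Rightarrow> real" where
  "log_step f x = - ln (P (\<lambda>y. exp (f y)) x)"

definition accel_log_step :: "('a \<Rightarrow> real) \<Rightarrow> 'a \<Rightarrow> real" where
  "accel_log_step f x = (log_step f x + log_step (log_step f) x) / 2"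

lemma P_exp_bounds:
  assumes "bdd f" "AE x in M. l \<le> f x \<and> f x \<le> u"
  shows "exp l \<le> P (\<lambda>y. exp (f y)) x" "P (\<lambda>y. exp (f y)) x \<le> exp u"
  using assms(2) by (auto intro!: P_ge P_le bdd_exp assms(1))

lemma P_exp_pos: assumes "bdd f" shows "0 < P (\<lambda>y. exp (f y)) x"
proof -
  obtain B where "AE x in M. \<bar>f x\<bar> \<le> B" using assms by (auto simp: bdd_def)
  then have "AE x in M. -B \<le> f x \<and> f x \<le> B" by eventually_elim auto
  from P_exp_bounds(1)[OF assms this, of x] show ?thesis using exp_gt_zero[of "-B"] by linarith
qed

lemma exp_log_step: "bdd f \<Longrightarrow> exp (log_step f x) = 1 / P (\<lambda>y. exp (f y)) x"
  using P_exp_pos[of f x] by (simp add: log_step_def exp_minus inverse_eq_divide)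

lemma log_step_bounds:
  assumes "bdd f" "AE x in M. l \<le> f x \<and> f x \<le> u" shows "- u \<le> log_step f x" "log_step f x \<le> - l"
  using P_exp_bounds[OF assms, of x] P_exp_pos[OF assms(1), of x]
    ln_le_cancel_iff[of "exp l" "P (\<lambda>y. exp (f y)) x"] ln_le_cancel_iff[of "P (\<lambda>y. exp (f y)) x" "exp u"]
  by (auto simp: log_step_def)

lemma log_step_abs_le:
  assumes "bdd f" "AE x in M. \<bar>f x\<bar> \<le> B" shows "\<bar>log_step f x\<bar> \<le> B"
proof -
  have "AE x in M. -B \<le> f x \<and> f x \<le> B" using assms(2) by eventually_elim auto
  from log_step_bounds[OF assms(1) this, of x] show ?thesis by auto
qed

lemma log_step_measurable[measurable]:
  assumes [measurable]: "f \<in> borel_measurable M" shows "log_step f \<in> borel_measurable M"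
  unfolding log_step_def by measurable

lemma bdd_log_step[simp]: assumes "bdd f" shows "bdd (log_step f)"
proof -
  obtain B where "AE x in M. \<bar>f x\<bar> \<le> B" using assms by (auto simp: bdd_def)
  from log_step_abs_le[OF assms this] show ?thesis using assms by (intro bddI[where B=B]) (auto simp: bdd_def)
qed

lemma bdd_accel[simp]: "bdd f \<Longrightarrow> bdd (accel_log_step f)"
  unfolding accel_log_step_def by simp

lemma accel_abs_le:
  assumes "bdd f" "AE x in M. \<bar>f x\<bar> \<le> B" shows "\<bar>accel_log_step f x\<bar> \<le> B"
proof -
  have "\<bar>log_step f x\<bar> \<le> B" for x by (rule log_step_abs_le[OF assms])
  moreover from this have "\<bar>log_step (log_step f) x\<bar> \<le> B" by (intro log_step_abs_le bdd_log_step assms) simp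
  ultimately have "\<bar>log_step f x\<bar> \<le> B" "\<bar>log_step (log_step f) x\<bar> \<le> B" by blast+
  then show ?thesis unfolding accel_log_step_def by (simp add: abs_le_iff)
qed

text \<open>The sign of the remainder is Jensen's inequality, obtained from the tangent of \<open>exp\<close> at \<open>P f x\<close>.
  The size follows from \<open>ln t \<le> t - 1\<close> and the quadratic remainder of \<open>exp\<close>.\<close>

lemma log_mean_exp_remainder:
  assumes f: "bdd f" and k: "AE x in M. \<bar>f x\<bar> \<le> k"
  shows "\<bar>log_step f x + P f x\<bar> \<le> k * exp k / 2 * P (\<lambda>y. \<bar>f y\<bar>) x"
proof -
  define c where "c = P f x"
  have "exp c = P (\<lambda>y. exp c * (1 + f y - c)) x"
    using f by (simp add: P_cmult P_add P_diff P_const c_def)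
  also have "\<dots> \<le> P (\<lambda>y. exp (f y)) x"
  proof (rule P_mono)
    show "AE y in M. exp c * (1 + f y - c) \<le> exp (f y)"
    proof (rule AE_I2)
      fix y
      have "exp c * (1 + (f y - c)) \<le> exp c * exp (f y - c)"
        by (intro mult_left_mono exp_ge_add_one_self) auto
      then show "exp c * (1 + f y - c) \<le> exp (f y)" by (simp add: add_diff_eq flip: exp_add)
    qed
  qed (use f in simp_all)
  finally have "c \<le> - log_step f x" using P_exp_pos[OF f, of x] by (simp add: log_step_def ln_ge_iff)
  moreover have "- log_step f x - c \<le> k * exp k / 2 * P (\<lambda>y. \<bar>f y\<bar>) x"
  proof -
    have "- log_step f x - c \<le> P (\<lambda>y. exp (f y)) x - 1 - P f x"
      using ln_le_minus_one[OF P_exp_pos[OF f, of x]] by (simp add: log_step_def c_def)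
    also have "\<dots> = P (\<lambda>y. exp (f y) - 1 - f y) x"
      using f by (simp add: P_diff P_const)
    also have "\<dots> \<le> P (\<lambda>y. k * exp k / 2 * \<bar>f y\<bar>) x"
    proof (rule P_mono)
      show "AE y in M. exp (f y) - 1 - f y \<le> k * exp k / 2 * \<bar>f y\<bar>"
        using k by eventually_elim (rule exp_quadratic_remainder)
    qed (use f in simp_all)
    finally show ?thesis by (subst (asm) P_cmult)
  qed
  ultimately show ?thesis unfolding c_def by linarith
qed

lemma nrm_log_mean_exp_remainder:
  assumes f: "bdd f" and k: "AE x in M. \<bar>f x\<bar> \<le> k" "0 \<le> k"
  shows "nrm (\<lambda>x. log_step f x + P f x) \<le> k * exp k / 2 * nrm f"
proof -
  have "nrm (\<lambda>x. log_step f x + P f x) \<le> nrm (\<lambda>x. k * exp k / 2 * P (\<lambda>y. \<bar>f y\<bar>) x)"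
    using log_mean_exp_remainder[OF f k(1)]
    by (intro nrm_mono_AE AE_I2 order_trans[OF _ abs_ge_self]) (use f in simp_all)
  also have "\<dots> = k * exp k / 2 * nrm (P (\<lambda>y. \<bar>f y\<bar>))"
    using k by (subst nrm_cmult) simp
  also have "nrm (P (\<lambda>y. \<bar>f y\<bar>)) \<le> nrm f"
    using nrm_P[of "\<lambda>y. \<bar>f y\<bar>"] f by (simp add: nrm_def ip_def)
  finally show ?thesis using k by (simp add: mult_left_mono)
qed

text \<open>With \<open>R h = log_step h + P h\<close>, the nonlinear part of a step, an accelerated step is exactly
  \<open>(R f - P (R f) + R (log_step f) - (P f - P\<^sup>2 f)) / 2\<close>.  Half of the last term has norm at most \<open>nrm f / 8\<close> and the others are of order \<open>\<epsilon> * nrm f\<close> with \<open>\<epsilon> = k e\<^sup>k / 2\<close>, giving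
  \<open>1/8 + \<epsilon> (3 + \<epsilon>) / 2\<close>, which the stated constant dominates.\<close>

lemma accel_local_contraction:
  assumes f: "bdd f" and k: "AE x in M. \<bar>f x\<bar> \<le> k" "0 \<le> k"
  shows "nrm (accel_log_step f) \<le> (1/8 + k * exp (4 * k) * (2 + 1/2 * k * exp (4 * k))) * nrm f"
proof -
  define \<epsilon> where "\<epsilon> = k * exp k / 2"
  define R where "R h x = log_step h x + P h x" for h x
  have R: "bdd (R h)" "nrm (R h) \<le> \<epsilon> * nrm h" if "bdd h" "AE x in M. \<bar>h x\<bar> \<le> k" for h
    using nrm_log_mean_exp_remainder[OF that k(2)] that by (simp_all add: R_def[abs_def] \<epsilon>_def)
  have \<epsilon>: "\<epsilon> \<ge> 0" using k by (simp add: \<epsilon>_def)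
  have Sk: "AE x in M. \<bar>log_step f x\<bar> \<le> k" using log_step_abs_le[OF f k(1)] by simp
  note Rf = R[OF f k(1)] and RS = R[OF bdd_log_step[OF f] Sk]
  have Sf: "log_step f = (\<lambda>x. R f x - P f x)" by (simp add: R_def fun_eq_iff)
  have "nrm (log_step f) \<le> nrm (R f) + nrm (P f)" unfolding Sf using f Rf by (intro nrm_triangle_diff) auto
  then have nS: "nrm (log_step f) \<le> (1 + \<epsilon>) * nrm f" using Rf nrm_P[OF f] by (simp add: algebra_simps)
  have PS: "P (log_step f) x = P (R f) x - P (P f) x" for x
    unfolding Sf using f Rf by (simp add: P_diff)
  define L where "L = (\<lambda>x. P f x - P (P f) x)"
  have L: "bdd L" "nrm L \<le> nrm f / 4" using f nrm_P_minus_square[OF f] by (simp_all add: L_def)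
  have eq: "accel_log_step f = (\<lambda>x. (1/2) * (R f x - P (R f) x + R (log_step f) x - L x))"
  proof
    fix x
    have "log_step (log_step f) x = R (log_step f) x - P (log_step f) x" by (simp add: R_def)
    then show "accel_log_step f x = (1/2) * (R f x - P (R f) x + R (log_step f) x - L x)"
      unfolding accel_log_step_def PS L_def using fun_cong[OF Sf, of x] by simp
  qed
  have "nrm (\<lambda>x. R f x - P (R f) x + R (log_step f) x - L x)
     \<le> nrm (\<lambda>x. R f x - P (R f) x + R (log_step f) x) + nrm L"
    using Rf RS L by (intro nrm_triangle_diff) auto
  also have "nrm (\<lambda>x. R f x - P (R f) x + R (log_step f) x) \<le> nrm (\<lambda>x. R f x - P (R f) x) + nrm (R (log_step f))"
    using Rf RS by (intro nrm_triangle) auto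
  also have "nrm (\<lambda>x. R f x - P (R f) x) \<le> nrm (R f) + nrm (P (R f))"
    using Rf by (intro nrm_triangle_diff) auto
  finally have "2 * nrm (accel_log_step f) \<le> 2 * nrm (R f) + nrm (R (log_step f)) + nrm f / 4"
    unfolding eq nrm_cmult using nrm_P[OF Rf(1)] L(2) by simp
  also have "\<dots> \<le> 2 * (\<epsilon> * nrm f) + \<epsilon> * ((1 + \<epsilon>) * nrm f) + nrm f / 4"
    using Rf(2) RS(2) mult_left_mono[OF nS \<epsilon>] by linarith
  also have "\<dots> = 2 * ((1/8 + \<epsilon> * (3 + \<epsilon>) / 2) * nrm f)" by (simp add: field_simps)
  finally have "nrm (accel_log_step f) \<le> (1/8 + \<epsilon> * (3 + \<epsilon>) / 2) * nrm f" by simp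
  also have "\<dots> \<le> (1/8 + k * exp (4 * k) * (2 + 1/2 * k * exp (4 * k))) * nrm f"
  proof (intro mult_right_mono add_left_mono)
    have "k * exp k \<le> k * exp (4 * k)" using k by (intro mult_left_mono) auto
    then have le: "\<epsilon> \<le> k * exp (4 * k) / 2" by (simp add: \<epsilon>_def)
    have "\<epsilon> * (3 + \<epsilon>) / 2 \<le> (k * exp (4 * k) / 2) * (3 + k * exp (4 * k) / 2) / 2"
      using le \<epsilon> by (intro divide_right_mono mult_mono) auto
    also have "\<dots> \<le> (k * exp (4 * k)) * (2 + k * exp (4 * k) / 2)"
    proof -
      define t where "t = k * exp (4 * k)"
      have "t \<ge> 0" using k by (simp add: t_def)
      then have "t * (16 + 4 * t) \<ge> t * (6 + t)" by (intro mult_left_mono) auto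
      then show ?thesis unfolding t_def[symmetric] by (simp add: algebra_simps)
    qed
    finally show "\<epsilon> * (3 + \<epsilon>) / 2 \<le> k * exp (4 * k) * (2 + 1/2 * k * exp (4 * k))" by simp
  qed simp
  finally show ?thesis .
qed

text \<open>An upper bound for the essential oscillation, that is, for the Hilbert metric between \<open>U e\<^sup>f\<close>
  and \<open>U\<close>.\<close>

definition osc_le :: "('a \<Rightarrow> real) \<Rightarrow> real \<Rightarrow> bool" where
  "osc_le f \<delta> \<longleftrightarrow> (\<exists>c. AE x in M. c \<le> f x \<and> f x \<le> c + \<delta>)"

lemma osc_leI_pairwise:
  assumes G: "AE x in M. x \<in> G" and pair: "\<And>x y. x \<in> G \<Longrightarrow> y \<in> G \<Longrightarrow> f x - f y \<le> \<delta>"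
  shows "osc_le f \<delta>"
proof (cases "G = {}")
  case False
  then obtain w where w: "w \<in> G" by blast
  have bd: "bdd_below (f ` G)" using pair[OF w] by (intro bdd_belowI2[of _ "f w - \<delta>"]) (simp add: diff_le_eq add.commute)
  have "f x - \<delta> \<le> Inf (f ` G)" if "x \<in> G" for x
    using pair[OF that] by (intro cINF_greatest[OF False]) (simp add: diff_le_eq add.commute)
  then have "\<And>x. x \<in> G \<Longrightarrow> Inf (f ` G) \<le> f x \<and> f x \<le> Inf (f ` G) + \<delta>"
    using cINF_lower[OF bd] by (force simp: diff_le_eq)
  then have "AE x in M. Inf (f ` G) \<le> f x \<and> f x \<le> Inf (f ` G) + \<delta>"
    using G by (rule eventually_mono[rotated])
  then show ?thesis unfolding osc_le_def by blast
qed (use G in \<open>auto simp: osc_le_def\<close>)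

text \<open>After a step, \<open>exp (2 * accel_log_step f) = a / P a\<close> for \<open>a = exp (log_step f)\<close>.  As \<open>a\<close> and \<open>P a\<close> have the same positive
  integral, this quotient can be neither above 1 nor below 1 almost everywhere by a fixed factor.
  This is where the scaling freedom of the projective metric is removed.\<close>

lemma accel_range_meets_zero:
  assumes nz: "emeasure M (space M) \<noteq> 0" and f: "bdd f"
  shows "AE x in M. c \<le> accel_log_step f x \<Longrightarrow> c \<le> 0" "AE x in M. accel_log_step f x \<le> c \<Longrightarrow> 0 \<le> c"
proof -
  define a where "a = (\<lambda>x. exp (log_step f x))"
  have a: "bdd a" using f by (simp add: a_def)
  obtain B where "AE x in M. \<bar>log_step f x\<bar> \<le> B" using f bdd_log_step[OF f] by (auto simp: bdd_def)
  then have "AE x in M. exp (-B) \<le> a x" by eventually_elim (simp add: a_def)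
  then have "(\<integral>x. exp (-B) \<partial>M) \<le> (\<integral>x. a x \<partial>M)" using a by (intro integral_mono_AE) auto
  moreover have "measure M (space M) \<noteq> 0" using nz unfolding emeasure_eq_measure by (metis ennreal_0)
  then have "(\<integral>x. exp (-B) \<partial>M) > 0" by (simp add: zero_less_measure_iff)
  ultimately have pos: "(\<integral>x. a x \<partial>M) > 0" by linarith
  have eq: "exp (2 * accel_log_step f x) * P a x = a x" for x
  proof -
    have "2 * accel_log_step f x = log_step f x + log_step (log_step f) x" by (simp add: accel_log_step_def)
    then show ?thesis using exp_log_step[OF bdd_log_step[OF f], of x] P_exp_pos[OF bdd_log_step[OF f], of x] by (simp add: exp_add a_def)
  qed
  have Pa: "P a x > 0" for x using P_exp_pos[OF bdd_log_step[OF f], of x] by (simp add: a_def)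
  { assume "AE x in M. c \<le> accel_log_step f x"
    then have "AE x in M. exp (2 * c) * P a x \<le> a x"
    proof eventually_elim
      case (elim x)
      have "exp (2 * c) * P a x \<le> exp (2 * accel_log_step f x) * P a x"
        using elim Pa[of x] by (intro mult_right_mono) auto
      then show ?case by (simp only: eq)
    qed
    then have "(\<integral>x. exp (2 * c) * P a x \<partial>M) \<le> (\<integral>x. a x \<partial>M)" using a by (intro integral_mono_AE) auto
    then have "exp (2 * c) * (\<integral>x. a x \<partial>M) \<le> 1 * (\<integral>x. a x \<partial>M)" using integral_P[OF a] by simp
    then show "c \<le> 0" using pos by (simp only: mult_le_cancel_right_pos) simp }
  { assume "AE x in M. accel_log_step f x \<le> c"
    then have "AE x in M. a x \<le> exp (2 * c) * P a x"
    proof eventually_elim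
      case (elim x)
      have "exp (2 * accel_log_step f x) * P a x \<le> exp (2 * c) * P a x"
        using elim Pa[of x] by (intro mult_right_mono) auto
      then show ?case by (simp only: eq)
    qed
    then have "(\<integral>x. a x \<partial>M) \<le> (\<integral>x. exp (2 * c) * P a x \<partial>M)" using a by (intro integral_mono_AE) auto
    then have "1 * (\<integral>x. a x \<partial>M) \<le> exp (2 * c) * (\<integral>x. a x \<partial>M)" using integral_P[OF a] by simp
    then show "0 \<le> c" using pos by (simp only: mult_le_cancel_right_pos) simp }
qed

lemma accel_abs_le_osc:
  assumes "emeasure M (space M) \<noteq> 0" "bdd f" "osc_le (accel_log_step f) \<delta>"
  shows "AE x in M. \<bar>accel_log_step f x\<bar> \<le> \<delta>"
proof -
  obtain c where c: "AE x in M. c \<le> accel_log_step f x \<and> accel_log_step f x \<le> c + \<delta>"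
    using assms(3) by (auto simp: osc_le_def)
  have "c \<le> 0" using c by (intro accel_range_meets_zero(1)[OF assms(1,2)]) auto
  moreover have "0 \<le> c + \<delta>" using c by (intro accel_range_meets_zero(2)[OF assms(1,2)]) auto
  ultimately show ?thesis using c by (intro eventually_mono[OF c]) auto
qed

end

locale contracting_markov = symmetric_markov +
  fixes D :: real and G :: "'a set"
  assumes D_nonneg: "0 \<le> D"
    and AE_G: "AE x in M. x \<in> G"
    and cross_ratio: "z \<in> G \<Longrightarrow> w \<in> G \<Longrightarrow>
      AE x in M. AE y in M. p z x * p w y \<le> exp D * (p w x * p z y)"
begin

lemma osc_le_log_step:
  assumes f: "bdd f" and \<delta>: "osc_le f \<delta>" "0 \<le> \<delta>"
  shows "osc_le (log_step f) (tanh (D/4) * \<delta>)"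
proof -
  obtain c where c: "AE x in M. c \<le> f x \<and> f x \<le> c + \<delta>" using \<delta>(1) by (auto simp: osc_le_def)
  show ?thesis
  proof (rule osc_leI_pairwise[OF AE_G])
    fix w z assume wz: "w \<in> G" "z \<in> G"
    have "P (\<lambda>y. exp (f y)) z \<le> exp (tanh (D/4) * \<delta>) * P (\<lambda>y. exp (f y)) w"
      unfolding P_def
    proof (rule birkhoff_two_densities[OF D_nonneg \<delta>(2) exp_ge_zero[of c]
          p_integrable p_nonneg p_total p_integrable p_nonneg p_total cross_ratio[OF wz(2,1)]])
      show "(\<lambda>y. exp (f y)) \<in> borel_measurable M" using bdd_exp[OF f] by (simp only: bdd_def)
      show "AE x in M. exp c \<le> exp (f x) \<and> exp (f x) \<le> exp c * exp \<delta>"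
        using c by eventually_elim (simp flip: exp_add)
    qed
    then have "ln (P (\<lambda>y. exp (f y)) z) \<le> ln (exp (tanh (D/4) * \<delta>) * P (\<lambda>y. exp (f y)) w)"
      using P_exp_pos[OF f] by (subst ln_le_cancel_iff) auto
    also have "\<dots> = tanh (D/4) * \<delta> + ln (P (\<lambda>y. exp (f y)) w)"
      using P_exp_pos[OF f, of w] by (simp add: ln_mult_pos)
    finally show "log_step f w - log_step f z \<le> tanh (D/4) * \<delta>" by (simp add: log_step_def)
  qed
qed

lemma osc_le_accel:
  assumes f: "bdd f" and \<delta>: "osc_le f \<delta>" "0 \<le> \<delta>"
  shows "osc_le (accel_log_step f) (tanh (D/4) * ((1 + tanh (D/4)) / 2) * \<delta>)"
proof -
  define \<theta> where "\<theta> = tanh (D/4)"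
  have "\<theta> \<ge> 0" using D_nonneg by (simp add: \<theta>_def)
  have 1: "osc_le (log_step f) (\<theta> * \<delta>)" using osc_le_log_step[OF assms] by (simp add: \<theta>_def)
  have 2: "osc_le (log_step (log_step f)) (\<theta> * (\<theta> * \<delta>))"
    using osc_le_log_step[OF bdd_log_step[OF f] 1] \<delta> \<open>\<theta> \<ge> 0\<close> by (simp add: \<theta>_def)
  from 1 2 obtain c d where "AE x in M. c \<le> log_step f x \<and> log_step f x \<le> c + \<theta> * \<delta>"
    "AE x in M. d \<le> log_step (log_step f) x \<and> log_step (log_step f) x \<le> d + \<theta> * (\<theta> * \<delta>)" by (auto simp: osc_le_def)
  then have "AE x in M. (c + d)/2 \<le> accel_log_step f x \<and> accel_log_step f x \<le> (c + d)/2 + \<theta> * ((1 + \<theta>) / 2) * \<delta>"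
    by eventually_elim (auto simp: accel_log_step_def field_simps)
  then show ?thesis unfolding osc_le_def \<theta>_def by blast
qed

end

section \<open>The projective diameter as a cross-ratio bound\<close>

text \<open>By second countability the complement of the support is a countable union of null sets.\<close>

lemma AE_measure_support:
  fixes M :: "'a::second_countable_topology measure"
  assumes "sets M = sets borel" shows "AE x in M. x \<in> measure_support M"
proof -
  obtain B :: "'a set set" where B: "countable B" "topological_basis B" using ex_countable_basis by blast
  define N where "N = \<Union>{b \<in> B. emeasure M b = 0}"
  have "N \<in> null_sets M"
    unfolding N_def
  proof (rule null_sets_UN'[where N="\<lambda>b. b" and I="{b \<in> B. emeasure M b = 0}", simplified])
    show "countable {b \<in> B. emeasure M b = 0}" using B(1) by (rule countable_subset[rotated]) auto
    show "\<And>b. b \<in> B \<and> emeasure M b = 0 \<Longrightarrow> b \<in> null_sets M"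
      using topological_basis_open[OF B(2)] assms by (auto simp: null_sets_def)
  qed
  moreover have "x \<in> N" if "x \<notin> measure_support M" for x
  proof -
    from that obtain V where V: "open V" "x \<in> V" "emeasure M V = 0"
      by (auto simp: measure_support_def)
    then obtain b where b: "b \<in> B" "x \<in> b" "b \<subseteq> V" using topological_basisE[OF B(2)] by metis
    have "emeasure M b \<le> emeasure M V" using b V assms by (intro emeasure_mono) auto
    then show ?thesis using V b by (auto simp: N_def)
  qed
  ultimately show ?thesis by (intro AE_I'[of N]) auto
qed

lemma hilbert_metric_pairwise:
  assumes "z \<in> A" "w \<in> A"
  shows "ereal (ln (\<phi> z / \<psi> z) - ln (\<phi> w / \<psi> w)) \<le> hilbert_metric A \<phi> \<psi>"
proof -
  have "ereal (ln (\<phi> z / \<psi> z)) - ereal (ln (\<phi> w / \<psi> w)) \<le> hilbert_metric A \<phi> \<psi>"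
    unfolding hilbert_metric_def using assms by (intro ereal_minus_mono SUP_upper INF_lower)
  then show ?thesis by simp
qed

text \<open>A rate below 1 means that the projective diameter is a real number \<open>D\<close>.  Reading the supremum and
  infimum of the Hilbert metric at single points turns it into a bound on cross ratios.\<close>

lemma contraction_rate_diameter:
  assumes ne: "measure_support M \<noteq> {}"
    and pos: "\<And>x y. x \<in> measure_support M \<Longrightarrow> y \<in> measure_support M \<Longrightarrow> 0 < \<kappa> x y"
    and lt: "contraction_rate M \<kappa> < 1"
  obtains D where "0 \<le> D" "contraction_rate M \<kappa> = tanh (D / 4)"
    "\<And>z w x y. z \<in> measure_support M \<Longrightarrow> w \<in> measure_support M \<Longrightarrow> x \<in> measure_support M \<Longrightarrow>
       y \<in> measure_support M \<Longrightarrow> \<kappa> z x * \<kappa> w y \<le> exp D * (\<kappa> w x * \<kappa> z y)"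
proof -
  define A where "A = measure_support M"
  define h where "h x y = hilbert_metric A (\<lambda>z. \<kappa> z x) (\<lambda>z. \<kappa> z y)" for x y
  define T where "T = (SUP x\<in>A. SUP y\<in>A. h x y)"
  have upper: "h x y \<le> T" if "x \<in> A" "y \<in> A" for x y
    unfolding T_def using that by (meson SUP_upper2 order_refl)
  obtain x0 where x0: "x0 \<in> A" using ne by (auto simp: A_def)
  have "0 \<le> h x0 x0" unfolding h_def using hilbert_metric_pairwise[OF x0 x0, of "\<lambda>z. \<kappa> z x0" "\<lambda>z. \<kappa> z x0"]
    by (simp add: zero_ereal_def)
  then have "0 \<le> T" using upper[OF x0 x0] by simp
  have rate: "contraction_rate M \<kappa> = tanh_ereal (T / 4)"
    by (simp add: contraction_rate_def T_def h_def A_def)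
  have "T \<noteq> \<infinity>" using lt rate by (auto simp: tanh_ereal_def)
  with \<open>0 \<le> T\<close> obtain D where D: "T = ereal D" "0 \<le> D" by (cases T) auto
  show ?thesis
  proof
    show "0 \<le> D" by fact
    show "contraction_rate M \<kappa> = tanh (D / 4)" unfolding rate D by (simp add: tanh_ereal_def)
    fix z w x y assume in_A: "z \<in> measure_support M" "w \<in> measure_support M" "x \<in> measure_support M" "y \<in> measure_support M"
    have "ereal (ln (\<kappa> z x / \<kappa> z y) - ln (\<kappa> w x / \<kappa> w y)) \<le> ereal D"
      using hilbert_metric_pairwise[of z A w "\<lambda>z. \<kappa> z x" "\<lambda>z. \<kappa> z y"] upper[of x y] in_A D
      unfolding A_def[symmetric] h_def by (metis order_trans)
    then have "ln (\<kappa> z x * \<kappa> w y) \<le> ln (exp D * (\<kappa> w x * \<kappa> z y))"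
      using in_A by (simp add: pos ln_mult_pos ln_divide_pos)
    then show "\<kappa> z x * \<kappa> w y \<le> exp D * (\<kappa> w x * \<kappa> z y)"
      using in_A by (subst (asm) ln_le_cancel_iff) (auto intro!: mult_pos_pos pos)
  qed
qed

section \<open>The kernel of a Sinkhorn problem\<close>

text \<open>The set \<open>G\<close> has full measure, and on it the hypotheses that are given almost everywhere, or on the
  support, hold at every point.  Fixing it once keeps the topology out of the argument.\<close>

locale sinkhorn_problem =
  fixes M :: "'a measure" and \<kappa> :: "'a \<Rightarrow> 'a \<Rightarrow> real" and U :: "'a \<Rightarrow> real"
    and D :: real and G :: "'a set"
  assumes nonzero: "emeasure M (space M) \<noteq> 0"
    and kernel_measurable[measurable]: "(\<lambda>(x, y). \<kappa> x y) \<in> borel_measurable (M \<Otimes>\<^sub>M M)"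
    and G_sets[measurable]: "G \<in> sets M" and AE_G: "AE x in M. x \<in> G"
    and kernel_pos: "\<And>x y. x \<in> G \<Longrightarrow> y \<in> G \<Longrightarrow> 0 < \<kappa> x y"
    and D_nonneg: "0 \<le> D"
    and kernel_cross_ratio: "\<And>z w x y. z \<in> G \<Longrightarrow> w \<in> G \<Longrightarrow> x \<in> G \<Longrightarrow> y \<in> G \<Longrightarrow>
       \<kappa> z x * \<kappa> w y \<le> exp D * (\<kappa> w x * \<kappa> z y)"
    and bounded_L2: "kernel_op_bounded M (L2_norm M) \<kappa>"
    and pos_semidef: "kernel_op_pos_semidef M \<kappa>"
    and self_adjoint: "kernel_op_self_adjoint M \<kappa>"
    and U_measurable[measurable]: "U \<in> borel_measurable M"
    and U_pos: "\<And>x. x \<in> G \<Longrightarrow> 0 < U x"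
    and U_solves: "\<And>x. x \<in> G \<Longrightarrow> U x * kernel_op M \<kappa> U x = 1"
begin

lemma G_space: "x \<in> G \<Longrightarrow> x \<in> space M"
  using sets.sets_into_space[OF G_sets] by blast

lemma kernel_section_measurable: "x \<in> G \<Longrightarrow> \<kappa> x \<in> borel_measurable M"
  using measurable_Pair2[OF kernel_measurable, of x] G_space by simp

lemma G_nonempty: "G \<noteq> {}"
proof
  assume "G = {}"
  then have "AE x in M. False" using AE_G by simp
  then show False using nonzero by (simp add: AE_iff_measurable[of "space M"])
qed

lemma kernel_U_integrable: "x \<in> G \<Longrightarrow> integrable M (\<lambda>y. \<kappa> x y * U y)"
  \<comment> \<open>otherwise the integral would be 0 by convention, and so would \<open>U x * kernel_op M \<kappa> U x\<close>\<close>
  using U_solves[of x] not_integrable_integral_eq[of M "\<lambda>y. \<kappa> x y * U y"]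
  unfolding kernel_op_def by force

lemma kernel_U_value: "x \<in> G \<Longrightarrow> (\<integral>y. \<kappa> x y * U y \<partial>M) = 1 / U x"
  using U_solves[of x] U_pos[of x] by (simp add: kernel_op_def field_simps)

lemma AE_kernel_U_pos: "x \<in> G \<Longrightarrow> AE y in M. 0 < \<kappa> x y * U y"
  using AE_G by eventually_elim (simp add: kernel_pos U_pos)

text \<open>At a good point \<open>w\<close> the function \<open>y \<mapsto> \<kappa> w y * U y\<close> is integrable, since its integral is not 0, and it
  is positive almost everywhere.  So \<open>M\<close> has a density with respect to a finite measure.\<close>

lemma sigma_finite_space: "sigma_finite_measure M"
proof -
  obtain w where w: "w \<in> G" using G_nonempty by blast
  define g where "g y = ennreal (\<kappa> w y * U y)" for y
  have [measurable]: "g \<in> borel_measurable M"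
    unfolding g_def using kernel_U_integrable[OF w] by measurable
  have "(\<integral>\<^sup>+y. g y \<partial>M) < \<infinity>"
    unfolding g_def by (subst nn_integral_eq_integral[OF kernel_U_integrable[OF w]])
      (use AE_kernel_U_pos[OF w] in \<open>auto elim: eventually_mono\<close>)
  then have fin: "finite_measure (density M g)"
    by (intro finite_measureI) (simp add: emeasure_density cong: nn_integral_cong)
  have "AE y in M. g y * (1 / g y) = 1"
    using AE_kernel_U_pos[OF w] by eventually_elim (simp add: g_def ennreal_times_divide ennreal_divide_self[OF less_imp_neq[THEN not_sym]])
  then have "density M (\<lambda>y. g y * (1 / g y)) = density M (\<lambda>_. 1)"
    by (intro density_cong) auto
  then have "density (density M g) (\<lambda>y. 1 / g y) = M"
    by (subst density_density_eq) (auto simp: density_1)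
  moreover have "sigma_finite_measure (density (density M g) (\<lambda>y. 1 / g y))"
  proof (subst sigma_finite_measure.sigma_finite_iff_density_finite)
    show "sigma_finite_measure (density M g)" using fin by (simp add: finite_measure_def)
    show "AE y in density M g. 1 / g y \<noteq> \<infinity>"
      using AE_kernel_U_pos[OF w] by (subst AE_density) (auto elim!: eventually_mono simp: g_def ennreal_divide_eq_top_iff)
  qed auto
  ultimately show ?thesis by simp
qed

end

sublocale sinkhorn_problem \<subseteq> sigma_finite_measure M by (rule sigma_finite_space)

lemma L2_norm_finite_iff:
  "L2_norm M f < \<infinity> \<longleftrightarrow> f \<in> borel_measurable M \<and> integrable M (\<lambda>x. (f x)\<^sup>2)"
  by (simp add: L2_norm_def)

lemma integrable_L2_mult:
  fixes f g :: "'a \<Rightarrow> real"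
  assumes "f \<in> borel_measurable M" "integrable M (\<lambda>x. (f x)\<^sup>2)"
    and "g \<in> borel_measurable M" "integrable M (\<lambda>x. (g x)\<^sup>2)"
  shows "integrable M (\<lambda>x. f x * g x)"
proof (rule Bochner_Integration.integrable_bound)
  show "integrable M (\<lambda>x. (f x)\<^sup>2 + (g x)\<^sup>2)" using assms by auto
  show "(\<lambda>x. f x * g x) \<in> borel_measurable M" using assms by auto
  show "AE x in M. norm (f x * g x) \<le> norm ((f x)\<^sup>2 + (g x)\<^sup>2)"
  proof (rule AE_I2)
    fix x
    have "2 * (\<bar>f x\<bar> * \<bar>g x\<bar>) \<le> (f x)\<^sup>2 + (g x)\<^sup>2"
      using sum_squares_bound[of "\<bar>f x\<bar>" "\<bar>g x\<bar>"] by simp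
    moreover have "0 \<le> \<bar>f x\<bar> * \<bar>g x\<bar>" by simp
    ultimately have "\<bar>f x\<bar> * \<bar>g x\<bar> \<le> (f x)\<^sup>2 + (g x)\<^sup>2" by linarith
    then show "norm (f x * g x) \<le> norm ((f x)\<^sup>2 + (g x)\<^sup>2)" by (simp add: abs_mult)
  qed
qed

context sinkhorn_problem
begin

text \<open>The operator on functions with values in \<open>[0, \<infinity>]\<close>, where no integrability has to be checked: \<open>U\<close> need
  not be square integrable, so self-adjointness on \<open>L\<^sup>2\<close> does not apply to it directly.\<close>

definition nn_op :: "('a \<Rightarrow> ennreal) \<Rightarrow> 'a \<Rightarrow> ennreal" where
  "nn_op f x = (\<integral>\<^sup>+y. ennreal (\<kappa> x y) * f y \<partial>M)"

lemma nn_op_measurable[measurable]: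
  assumes [measurable]: "f \<in> borel_measurable M" shows "nn_op f \<in> borel_measurable M"
  unfolding nn_op_def by measurable

lemma kernel_op_measurable[measurable]:
  assumes [measurable]: "f \<in> borel_measurable M" shows "kernel_op M \<kappa> f \<in> borel_measurable M"
  unfolding kernel_op_def by measurable

lemma nn_op_eq_kernel_op:
  assumes x: "x \<in> G" and int: "integrable M (\<lambda>y. \<kappa> x y * f y)" and f: "AE y in M. 0 \<le> f y"
  shows "nn_op (\<lambda>y. ennreal (f y)) x = ennreal (kernel_op M \<kappa> f x)" "0 \<le> kernel_op M \<kappa> f x"
proof -
  have nn: "AE y in M. 0 \<le> \<kappa> x y * f y"
    using AE_G f by eventually_elim (simp add: kernel_pos[OF x] less_imp_le)
  have "nn_op (\<lambda>y. ennreal (f y)) x = (\<integral>\<^sup>+y. ennreal (\<kappa> x y * f y) \<partial>M)"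
    unfolding nn_op_def
  proof (rule nn_integral_cong_AE)
    show "AE y in M. ennreal (\<kappa> x y) * ennreal (f y) = ennreal (\<kappa> x y * f y)"
      using AE_G f by eventually_elim (simp add: ennreal_mult kernel_pos[OF x] less_imp_le)
  qed
  then show "nn_op (\<lambda>y. ennreal (f y)) x = ennreal (kernel_op M \<kappa> f x)"
    using nn_integral_eq_integral[OF int nn] by (simp add: kernel_op_def)
  show "0 \<le> kernel_op M \<kappa> f x" unfolding kernel_op_def by (rule integral_nonneg_AE[OF nn])
qed

lemma kernel_op_L2:
  assumes [measurable]: "f \<in> borel_measurable M" and f: "integrable M (\<lambda>x. (f x)\<^sup>2)"
  shows "AE x in M. integrable M (\<lambda>y. \<kappa> x y * f y)"
    "integrable M (\<lambda>x. (kernel_op M \<kappa> f x)\<^sup>2)"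
proof -
  have fin: "L2_norm M f < \<infinity>" unfolding L2_norm_finite_iff using assms by simp
  obtain C where C: "kernel_op_defined M \<kappa> f" "L2_norm M (kernel_op M \<kappa> f) \<le> ennreal C * L2_norm M f"
    using bounded_L2 fin unfolding kernel_op_bounded_def by blast
  then show "AE x in M. integrable M (\<lambda>y. \<kappa> x y * f y)" by (simp add: kernel_op_defined_def)
  have "ennreal C * L2_norm M f < \<infinity>" using fin by (simp add: ennreal_mult_less_top)
  then have "L2_norm M (kernel_op M \<kappa> f) < \<infinity>" using C(2) by (rule order.strict_trans1[rotated])
  then show "integrable M (\<lambda>x. (kernel_op M \<kappa> f x)\<^sup>2)" unfolding L2_norm_finite_iff by simp
qed

definition nn_form :: "('a \<Rightarrow> ennreal) \<Rightarrow> ('a \<Rightarrow> ennreal) \<Rightarrow> ennreal" where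
  "nn_form f h = (\<integral>\<^sup>+x. h x * nn_op f x \<partial>M)"

lemma nn_form_L2:
  assumes f[measurable]: "f \<in> borel_measurable M" and f2: "integrable M (\<lambda>x. (f x)\<^sup>2)" "\<And>x. 0 \<le> f x"
    and h[measurable]: "h \<in> borel_measurable M" and h2: "integrable M (\<lambda>x. (h x)\<^sup>2)" "\<And>x. 0 \<le> h x"
  shows "nn_form (\<lambda>x. ennreal (f x)) (\<lambda>x. ennreal (h x)) = ennreal (\<integral>x. h x * kernel_op M \<kappa> f x \<partial>M)"
proof -
  have "AE x in M. nn_op (\<lambda>y. ennreal (f y)) x = ennreal (kernel_op M \<kappa> f x) \<and> 0 \<le> kernel_op M \<kappa> f x"
    using AE_G kernel_op_L2(1)[OF f f2(1)] by eventually_elim (use nn_op_eq_kernel_op f2 in auto)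
  then have AE: "AE x in M. ennreal (h x) * nn_op (\<lambda>y. ennreal (f y)) x = ennreal (h x * kernel_op M \<kappa> f x)"
    "AE x in M. 0 \<le> h x * kernel_op M \<kappa> f x"
    by (eventually_elim, simp add: ennreal_mult h2)+
  have int: "integrable M (\<lambda>x. h x * kernel_op M \<kappa> f x)"
    using kernel_op_L2(2)[OF f f2(1)] h2 by (intro integrable_L2_mult) auto
  show ?thesis unfolding nn_form_def
    by (subst nn_integral_cong_AE[OF AE(1)]) (rule nn_integral_eq_integral[OF int AE(2)])
qed

lemma nn_form_L2_sym:
  assumes f: "f \<in> borel_measurable M" "integrable M (\<lambda>x. (f x)\<^sup>2)" "\<And>x. 0 \<le> f x"
    and h: "h \<in> borel_measurable M" "integrable M (\<lambda>x. (h x)\<^sup>2)" "\<And>x. 0 \<le> h x"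
  shows "nn_form (\<lambda>x. ennreal (f x)) (\<lambda>x. ennreal (h x)) = nn_form (\<lambda>x. ennreal (h x)) (\<lambda>x. ennreal (f x))"
proof -
  have "(\<integral>x. kernel_op M \<kappa> f x * h x \<partial>M) = (\<integral>x. f x * kernel_op M \<kappa> h x \<partial>M)"
    using self_adjoint f h unfolding kernel_op_self_adjoint_def L2_norm_finite_iff by blast
  then show ?thesis unfolding nn_form_L2[OF f h] nn_form_L2[OF h f] by (simp add: mult.commute)
qed

lemma nn_op_SUP:
  assumes [measurable]: "\<And>i. g i \<in> borel_measurable M" and "incseq g" and that: "x \<in> space M"
  shows "nn_op (\<lambda>y. SUP i. g i y) x = (SUP i. nn_op (g i) x)"
proof -
  have [measurable]: "\<kappa> x \<in> borel_measurable M"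
    using measurable_Pair2[OF kernel_measurable that] by simp
  show ?thesis unfolding nn_op_def SUP_mult_left_ennreal using assms(2)
    by (intro nn_integral_monotone_convergence_SUP) (auto simp: incseq_def le_fun_def intro!: mult_left_mono)
qed

lemma nn_op_mono: "(\<And>y. f y \<le> g y) \<Longrightarrow> nn_op f x \<le> nn_op g x"
  unfolding nn_op_def by (intro nn_integral_mono mult_left_mono) auto

lemma nn_form_SUP_left:
  assumes [measurable]: "\<And>i. g i \<in> borel_measurable M" "h \<in> borel_measurable M" and inc: "incseq g"
  shows "nn_form (\<lambda>y. SUP i. g i y) h = (SUP i. nn_form (g i) h)"
proof -
  have "nn_form (\<lambda>y. SUP i. g i y) h = (\<integral>\<^sup>+x. (SUP i. h x * nn_op (g i) x) \<partial>M)"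
    unfolding nn_form_def SUP_mult_left_ennreal[symmetric]
    using assms by (intro nn_integral_cong) (simp add: nn_op_SUP)
  also have "\<dots> = (SUP i. nn_form (g i) h)"
    unfolding nn_form_def using inc
    by (intro nn_integral_monotone_convergence_SUP)
      (auto simp: incseq_def le_fun_def intro!: mult_left_mono nn_op_mono)
  finally show ?thesis .
qed

lemma nn_form_SUP_right:
  assumes [measurable]: "\<And>i. g i \<in> borel_measurable M" "f \<in> borel_measurable M" and inc: "incseq g"
  shows "nn_form f (\<lambda>y. SUP i. g i y) = (SUP i. nn_form f (g i))"
  unfolding nn_form_def SUP_mult_right_ennreal using inc
  by (intro nn_integral_monotone_convergence_SUP) (auto simp: incseq_def le_fun_def intro!: mult_right_mono)

text \<open>Cut off both the values and, by \<open>\<sigma>\<close>-finiteness, the domain.\<close>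

lemma L2_truncation:
  assumes [measurable]: "f \<in> borel_measurable M"
  obtains t :: "nat \<Rightarrow> 'a \<Rightarrow> real" where
    "\<And>i. t i \<in> borel_measurable M" "\<And>i. integrable M (\<lambda>x. (t i x)\<^sup>2)" "\<And>i x. 0 \<le> t i x"
    "incseq (\<lambda>i x. ennreal (t i x))" "\<And>x. x \<in> space M \<Longrightarrow> f x = (SUP i. ennreal (t i x))"
proof -
  obtain A :: "nat \<Rightarrow> 'a set" where A: "range A \<subseteq> sets M" "(\<Union>i. A i) = space M"
    "\<And>i. emeasure M (A i) \<noteq> \<infinity>" "incseq A" by (rule sigma_finite_incseq) blast
  then have [measurable]: "A i \<in> sets M" for i by auto
  define t where "t i x = indicator (A i) x * enn2real (min (f x) (of_nat i))" for i x
  have eq: "ennreal (t i x) = indicator (A i) x * min (f x) (of_nat i)" for i x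
  proof -
    have "min (f x) (of_nat i) < \<infinity>" by (simp add: min_less_iff_disj ennreal_of_nat_eq_real_of_nat)
    then show ?thesis by (simp add: t_def indicator_def)
  qed
  show ?thesis
  proof
    show [measurable]: "t i \<in> borel_measurable M" for i unfolding t_def by measurable
    show "0 \<le> t i x" for i x by (simp add: t_def)
    show "integrable M (\<lambda>x. (t i x)\<^sup>2)" for i
    proof (rule Bochner_Integration.integrable_bound)
      show "integrable M (\<lambda>x. (real i)\<^sup>2 * indicator (A i) x)"
        using A(3)[of i] by (simp add: less_top)
      show "AE x in M. norm ((t i x)\<^sup>2) \<le> norm ((real i)\<^sup>2 * indicator (A i) x)"
      proof (rule AE_I2)
        fix x
        have "enn2real (min (f x) (of_nat i)) \<le> real i"
          by (intro enn2real_leI) (auto simp: ennreal_of_nat_eq_real_of_nat)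
        then show "norm ((t i x)\<^sup>2) \<le> norm ((real i)\<^sup>2 * indicator (A i) x)"
          by (auto simp: t_def indicator_def intro!: power_mono)
      qed
    qed measurable
    show "incseq (\<lambda>i x. ennreal (t i x))"
    proof (intro incseq_SucI le_funI)
      fix i x
      have "A i \<subseteq> A (Suc i)" using A(4) by (simp add: incseq_Suc_iff)
      moreover have "min (f x) (of_nat i) \<le> min (f x) (of_nat (Suc i))"
        by (intro min.mono order_refl of_nat_mono) simp
      ultimately show "ennreal (t i x) \<le> ennreal (t (Suc i) x)"
        unfolding eq by (auto simp: indicator_def simp del: of_nat_Suc)
    qed
    show "f x = (SUP i. ennreal (t i x))" if x: "x \<in> space M" for x
    proof (rule antisym)
      show "(SUP i. ennreal (t i x)) \<le> f x"
        unfolding eq by (intro SUP_least) (auto simp: indicator_def)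
      obtain j where j: "x \<in> A j" using A(2) x by blast
      show "f x \<le> (SUP i. ennreal (t i x))"
      proof (rule dense_le)
        fix y assume y: "y < f x"
        then have "y < \<infinity>" using order.strict_trans2 top_greatest by (metis infinity_ennreal_def)
        then obtain n where n: "y < of_nat n" using ennreal_Ex_less_of_nat[of y] by auto
        have "A j \<subseteq> A (max j n)" using A(4) by (simp add: incseq_def)
        then have "x \<in> A (max j n)" using j by blast
        moreover have "(of_nat n :: ennreal) \<le> of_nat (max j n)" by (rule of_nat_mono) simp
        then have "y \<le> of_nat (max j n)" using n by (metis less_imp_le order.trans)
        ultimately have "y \<le> ennreal (t (max j n) x)" using y by (simp add: eq)
        then show "y \<le> (SUP i. ennreal (t i x))" by (rule SUP_upper2[OF UNIV_I])
      qed
    qed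
  qed
qed

lemma nn_form_cong: "(\<And>x. x \<in> space M \<Longrightarrow> f x = f' x) \<Longrightarrow> (\<And>x. x \<in> space M \<Longrightarrow> h x = h' x) \<Longrightarrow> nn_form f h = nn_form f' h'"
  unfolding nn_form_def nn_op_def by (auto intro!: nn_integral_cong arg_cong2[where f="(*)"])

text \<open>Monotone convergence in both arguments extends self-adjointness from \<open>L\<^sup>2\<close> to all nonnegative
  functions.\<close>

lemma nn_form_sym:
  assumes f: "f \<in> borel_measurable M" and h: "h \<in> borel_measurable M"
  shows "nn_form f h = nn_form h f"
proof -
  obtain s where s: "\<And>i. s i \<in> borel_measurable M" "\<And>i. integrable M (\<lambda>x. (s i x)\<^sup>2)" "\<And>i x. 0 \<le> s i x"
    "incseq (\<lambda>i x. ennreal (s i x))" "\<And>x. x \<in> space M \<Longrightarrow> f x = (SUP i. ennreal (s i x))"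
    using L2_truncation[OF f] by blast
  obtain t where t: "\<And>i. t i \<in> borel_measurable M" "\<And>i. integrable M (\<lambda>x. (t i x)\<^sup>2)" "\<And>i x. 0 \<le> t i x"
    "incseq (\<lambda>i x. ennreal (t i x))" "\<And>x. x \<in> space M \<Longrightarrow> h x = (SUP i. ennreal (t i x))"
    using L2_truncation[OF h] by blast
  note [measurable] = s(1) t(1)
  have "nn_form f h = nn_form (\<lambda>x. SUP i. ennreal (s i x)) (\<lambda>x. SUP j. ennreal (t j x))"
    using s(5) t(5) by (intro nn_form_cong) auto
  also have "\<dots> = (SUP i. SUP j. nn_form (\<lambda>x. ennreal (s i x)) (\<lambda>x. ennreal (t j x)))"
    by (subst nn_form_SUP_left[OF _ _ s(4)], simp, simp, subst nn_form_SUP_right[OF _ _ t(4)]) simp_all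
  also have "\<dots> = (SUP i. SUP j. nn_form (\<lambda>x. ennreal (t j x)) (\<lambda>x. ennreal (s i x)))"
    using nn_form_L2_sym[OF s(1-3) t(1-3)] by simp
  also have "\<dots> = nn_form (\<lambda>x. SUP j. ennreal (t j x)) (\<lambda>x. SUP i. ennreal (s i x))"
    by (subst nn_form_SUP_right[OF _ _ s(4)], simp, simp, subst nn_form_SUP_left[OF _ _ t(4)]) simp_all
  also have "\<dots> = nn_form h f"
    using s(5) t(5) by (intro nn_form_cong) auto
  finally show ?thesis .
qed

text \<open>Fix a good point \<open>w\<close>.  The cross-ratio bound says that \<open>\<kappa> x y\<close> equals \<open>\<alpha> x * \<kappa> w y\<close> up to factors \<open>e\<^sup>D\<close>
  and \<open>e\<^sup>-\<^sup>D\<close>.  From above, with \<open>K[U] = 1 / U\<close>, this gives a positive lower bound for \<open>U * \<alpha>\<close>; from below it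
  gives \<open>U * K[h] \<ge> U * \<alpha> * e\<^sup>-\<^sup>D * J\<close>, hence a positive lower bound for \<open>U * K[h]\<close>.  But by symmetry the
  integral of \<open>U * K[h]\<close> equals that of \<open>h * K[U] = h / U\<close>, which is finite for \<open>h = \<kappa> w * U\<^sup>2\<close>.\<close>

lemma finite_space: "finite_measure M"
proof (rule finite_measureI, rule notI)
  assume inf: "emeasure M (space M) = \<infinity>"
  obtain w where w: "w \<in> G" using G_nonempty by blast
  define h where "h y = \<kappa> w y * U y * U y" for y
  define c where "c = exp (- D) * exp (- D) * U w"
  note [measurable] = kernel_section_measurable[OF w]
  have h_meas[measurable]: "h \<in> borel_measurable M" unfolding h_def by measurable
  define J where "J = (\<integral>\<^sup>+y. ennreal (\<kappa> w y * h y) \<partial>M)"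
  have h_pos: "h y > 0" if "y \<in> G" for y using that by (simp add: h_def kernel_pos[OF w] U_pos)
  have "J \<noteq> 0"
  proof
    assume "J = 0"
    then have "AE y in M. ennreal (\<kappa> w y * h y) = 0"
      unfolding J_def by (subst (asm) nn_integral_0_iff_AE) auto
    with AE_G have "AE y in M. False"
      by eventually_elim (use h_pos kernel_pos[OF w] in \<open>force simp: ennreal_eq_0_iff dest: mult_pos_pos\<close>)
    then show False using nonzero by (simp add: AE_iff_measurable[of "space M"])
  qed
  have c: "c > 0" using U_pos[OF w] by (simp add: c_def)
  \<comment> \<open>\<open>c\<close> collects one factor \<open>e\<^sup>-\<^sup>D\<close> from the lower bound on \<open>U * \<alpha>\<close> and one from the lower bound on \<open>K[h]\<close>\<close>
  have lower: "ennreal c * J \<le> ennreal (U x) * nn_op (\<lambda>y. ennreal (h y)) x" if x: "x \<in> G" for x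
  proof -
    define \<alpha> where "\<alpha> = \<kappa> x w / \<kappa> w w"
    have ww: "\<kappa> w w > 0" and \<alpha>: "\<alpha> > 0" by (simp_all add: \<alpha>_def kernel_pos w x)
    have up: "\<kappa> x y \<le> exp D * \<alpha> * \<kappa> w y" and lo: "exp (- D) * \<alpha> * \<kappa> w y \<le> \<kappa> x y" if y: "y \<in> G" for y
      using kernel_cross_ratio[OF x w y w] kernel_cross_ratio[OF w x y w] ww
      by (simp_all add: \<alpha>_def field_simps exp_minus)
    have "1 / U x = (\<integral>y. \<kappa> x y * U y \<partial>M)" using kernel_U_value[OF x] by simp
    also have "\<dots> \<le> (\<integral>y. (exp D * \<alpha>) * (\<kappa> w y * U y) \<partial>M)"
    proof (rule integral_mono_AE)
      show "AE y in M. \<kappa> x y * U y \<le> exp D * \<alpha> * (\<kappa> w y * U y)"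
        using AE_G by eventually_elim (use up U_pos in \<open>auto simp: mult.assoc[symmetric] intro!: mult_right_mono less_imp_le\<close>)
    qed (use kernel_U_integrable x w in auto)
    also have "\<dots> = exp D * \<alpha> / U w" using kernel_U_value[OF w] by simp
    finally have "U w \<le> exp D * \<alpha> * U x" using U_pos[OF x] U_pos[OF w] by (simp add: field_simps)
    then have "exp (- D) * exp (- D) * U w \<le> exp (- D) * exp (- D) * (exp D * \<alpha> * U x)"
      by (rule mult_left_mono) simp
    then have "c \<le> U x * (exp (- D) * \<alpha>)" by (simp add: c_def exp_minus field_simps)
    then have "ennreal c * J \<le> ennreal (U x * (exp (- D) * \<alpha>)) * J"
      by (intro mult_right_mono ennreal_leI) auto
    also have "\<dots> = ennreal (U x) * (ennreal (exp (- D) * \<alpha>) * J)"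
      using \<alpha> U_pos[OF x] by (simp add: ennreal_mult mult.assoc)
    also have "ennreal (exp (- D) * \<alpha>) * J = (\<integral>\<^sup>+y. ennreal (exp (- D) * \<alpha>) * ennreal (\<kappa> w y * h y) \<partial>M)"
      unfolding J_def by (rule nn_integral_cmult[symmetric]) measurable
    also have "\<dots> \<le> nn_op (\<lambda>y. ennreal (h y)) x"
      unfolding nn_op_def
    proof (rule nn_integral_mono_AE)
      show "AE y in M. ennreal (exp (- D) * \<alpha>) * ennreal (\<kappa> w y * h y) \<le> ennreal (\<kappa> x y) * ennreal (h y)"
        using AE_G
      proof eventually_elim
        case (elim y)
        have "exp (- D) * \<alpha> * (\<kappa> w y * h y) \<le> \<kappa> x y * h y"
          using mult_right_mono[OF lo[OF elim] less_imp_le[OF h_pos[OF elim]]] by (simp add: mult.assoc)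
        then show ?case
          using \<alpha> h_pos[OF elim] kernel_pos[OF x elim] kernel_pos[OF w elim]
          by (simp add: ennreal_leI flip: ennreal_mult)
      qed
    qed
    finally show ?thesis by (simp add: mult_left_mono)
  qed
  have "\<infinity> = ennreal c * J * emeasure M (space M)"
    using c \<open>J \<noteq> 0\<close> inf by (simp add: ennreal_mult_top ennreal_mult_eq_top_iff)
  also have "\<dots> = (\<integral>\<^sup>+x. ennreal c * J \<partial>M)" by simp
  also have "\<dots> \<le> nn_form (\<lambda>y. ennreal (h y)) (\<lambda>x. ennreal (U x))"
    unfolding nn_form_def by (rule nn_integral_mono_AE) (use AE_G lower in \<open>auto elim: eventually_mono\<close>)
  also have "\<dots> = nn_form (\<lambda>x. ennreal (U x)) (\<lambda>y. ennreal (h y))" by (rule nn_form_sym) auto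
  also have "\<dots> = (\<integral>\<^sup>+x. ennreal (\<kappa> w x * U x) \<partial>M)"
    unfolding nn_form_def
  proof (rule nn_integral_cong_AE)
    have U_nn: "AE y in M. 0 \<le> U y" using AE_G by eventually_elim (simp add: U_pos less_imp_le)
    show "AE x in M. ennreal (h x) * nn_op (\<lambda>x. ennreal (U x)) x = ennreal (\<kappa> w x * U x)"
      using AE_G
    proof eventually_elim
      case (elim x)
      have "nn_op (\<lambda>x. ennreal (U x)) x = ennreal (1 / U x)"
        using nn_op_eq_kernel_op(1)[OF elim kernel_U_integrable[OF elim] U_nn] kernel_U_value[OF elim]
        by (simp add: kernel_op_def)
      then show ?case using U_pos[OF elim] h_pos[OF elim] by (simp add: h_def flip: ennreal_mult)
    qed
  qed
  also have "\<dots> < \<infinity>"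
    using kernel_U_integrable[OF w] AE_kernel_U_pos[OF w]
    by (subst nn_integral_eq_integral) (auto elim: eventually_mono)
  finally show False by simp
qed

end

section \<open>The Markov operator of a Sinkhorn problem\<close>

sublocale sinkhorn_problem \<subseteq> finite_measure M by (rule finite_space)

context sinkhorn_problem
begin

text \<open>Outside \<open>G\<close> the uniform density is used, so that every row is a probability density.\<close>

definition transition :: "'a \<Rightarrow> 'a \<Rightarrow> real" where
  "transition x y = (if x \<in> G then U x * \<kappa> x y * U y else 1 / measure M (space M))"

lemma measure_space_pos: "0 < measure M (space M)"
  using nonzero unfolding emeasure_eq_measure by (metis ennreal_0 zero_less_measure_iff)

lemma transition_measurable: "(\<lambda>(x, y). transition x y) \<in> borel_measurable (M \<Otimes>\<^sub>M M)"
  unfolding transition_def by measurable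

lemma transition_kernel_op:
  assumes "x \<in> G"
  shows "(\<integral>y. transition x y * f y \<partial>M) = U x * kernel_op M \<kappa> (\<lambda>y. U y * f y) x"
  using assms by (simp add: transition_def kernel_op_def mult.assoc)

lemma transition_integrable: "integrable M (transition x)"
proof (cases "x \<in> G")
  case True
  then have "integrable M (\<lambda>y. U x * (\<kappa> x y * U y))" by (intro integrable_mult_right kernel_U_integrable)
  then show ?thesis using True by (simp add: transition_def[abs_def] mult.assoc)
next
  case False
  have "integrable M (\<lambda>y. 1 / measure M (space M))" by simp
  then show ?thesis using False by (simp add: transition_def[abs_def])
qed

lemma transition_nonneg: "AE y in M. 0 \<le> transition x y"
  using AE_G by eventually_elim (simp add: transition_def kernel_pos U_pos less_imp_le)

lemma transition_total: "(\<integral>y. transition x y \<partial>M) = 1"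
proof (cases "x \<in> G")
  case True
  then show ?thesis using transition_kernel_op[OF True, of "\<lambda>_. 1"] U_solves[OF True] by simp
next
  case False
  then show ?thesis using measure_space_pos by (simp add: transition_def)
qed

lemma transition_times_integrable:
  "f \<in> borel_measurable M \<Longrightarrow> AE x in M. \<bar>f x\<bar> \<le> B \<Longrightarrow> integrable M (\<lambda>y. transition x y * f y)"
  by (rule integrable_times_bounded[OF transition_integrable])

lemma transition_abs_le:
  assumes f: "f \<in> borel_measurable M" "AE x in M. \<bar>f x\<bar> \<le> B"
  shows "\<bar>\<integral>y. transition x y * f y \<partial>M\<bar> \<le> B"
proof -
  have "\<bar>\<integral>y. transition x y * f y \<partial>M\<bar> \<le> (\<integral>y. \<bar>transition x y * f y\<bar> \<partial>M)"
    using integral_abs_bound by blast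
  also have "\<dots> \<le> (\<integral>y. B * transition x y \<partial>M)"
  proof (rule integral_mono_AE)
    show "AE y in M. \<bar>transition x y * f y\<bar> \<le> B * transition x y"
      using f(2) transition_nonneg[of x]
      by eventually_elim (simp add: abs_mult mult.commute mult_right_mono)
    show "integrable M (\<lambda>y. \<bar>transition x y * f y\<bar>)"
      by (rule integrable_abs[OF transition_times_integrable[OF f]])
    show "integrable M (\<lambda>y. B * transition x y)" by (rule integrable_mult_right[OF transition_integrable])
  qed
  also have "\<dots> = B" by (simp add: transition_total)
  finally show ?thesis .
qed

lemma transition_integral_measurable[measurable]:
  assumes [measurable]: "f \<in> borel_measurable M"
  shows "(\<lambda>x. \<integral>y. transition x y * f y \<partial>M) \<in> borel_measurable M"
proof -
  note [measurable] = transition_measurable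
  show ?thesis by measurable
qed

text \<open>Expresses the bilinear form of \<open>P\<close> through that of the kernel, for which symmetry is available.\<close>

lemma transition_form:
  assumes f[measurable]: "f \<in> borel_measurable M" and fB: "AE x in M. 0 \<le> f x \<and> f x \<le> B"
    and g[measurable]: "g \<in> borel_measurable M" and gB: "AE x in M. 0 \<le> g x \<and> g x \<le> B"
  shows "ennreal (\<integral>x. f x * (\<integral>y. transition x y * g y \<partial>M) \<partial>M)
    = nn_form (\<lambda>y. ennreal (U y * g y)) (\<lambda>x. ennreal (U x * f x))"
proof -
  have abs: "AE x in M. \<bar>f x\<bar> \<le> B" "AE x in M. \<bar>g x\<bar> \<le> B"
    using fB gB by (eventually_elim, simp)+
  define Q where "Q x = (\<integral>y. transition x y * g y \<partial>M)" for x
  have [measurable]: "Q \<in> borel_measurable M" unfolding Q_def by measurable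
  have Q0: "0 \<le> Q x" for x
    unfolding Q_def
  proof (rule integral_nonneg_AE)
    show "AE y in M. 0 \<le> transition x y * g y"
      using transition_nonneg[of x] gB by eventually_elim simp
  qed
  have "AE x in M. \<bar>Q x\<bar> \<le> B" using transition_abs_le[OF g abs(2)] by (simp add: Q_def)
  then have "integrable M (\<lambda>x. f x * Q x)"
    using abs by (intro integrable_times_bounded[where B=B] integrable_const_bound[where B=B]) auto
  moreover have "AE x in M. 0 \<le> f x * Q x" using fB by eventually_elim (simp add: Q0)
  ultimately have "ennreal (\<integral>x. f x * Q x \<partial>M) = (\<integral>\<^sup>+x. ennreal (f x * Q x) \<partial>M)"
    by (rule nn_integral_eq_integral[symmetric])
  also have "\<dots> = nn_form (\<lambda>y. ennreal (U y * g y)) (\<lambda>x. ennreal (U x * f x))"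
    unfolding nn_form_def
  proof (rule nn_integral_cong_AE)
    show "AE x in M. ennreal (f x * Q x) = ennreal (U x * f x) * nn_op (\<lambda>y. ennreal (U y * g y)) x"
      using AE_G fB
    proof eventually_elim
      case (elim x)
      have "integrable M (\<lambda>y. inverse (U x) * (transition x y * g y))"
        by (rule integrable_mult_right[OF transition_times_integrable[OF g abs(2)]])
      then have int: "integrable M (\<lambda>y. \<kappa> x y * (U y * g y))"
        using elim(1) U_pos[OF elim(1)] by (simp add: transition_def mult.assoc)
      have Ug: "AE y in M. 0 \<le> U y * g y" using AE_G gB by eventually_elim (simp add: U_pos less_imp_le)
      have "nn_op (\<lambda>y. ennreal (U y * g y)) x = ennreal (kernel_op M \<kappa> (\<lambda>y. U y * g y) x)"
        and K0: "0 \<le> kernel_op M \<kappa> (\<lambda>y. U y * g y) x"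
        using nn_op_eq_kernel_op[OF elim(1) int Ug] by auto
      moreover have "Q x = U x * kernel_op M \<kappa> (\<lambda>y. U y * g y) x"
        unfolding Q_def by (rule transition_kernel_op[OF elim(1)])
      ultimately show ?case
        using elim U_pos[OF elim(1)] by (simp add: mult_ac less_imp_le flip: ennreal_mult)
    qed
  qed
  finally show ?thesis unfolding Q_def .
qed

lemma transition_symmetric:
  assumes f[measurable]: "f \<in> borel_measurable M" and g[measurable]: "g \<in> borel_measurable M"
    and fB: "AE x in M. 0 \<le> f x \<and> f x \<le> B" and gB: "AE x in M. 0 \<le> g x \<and> g x \<le> B"
  shows "(\<integral>x. f x * (\<integral>y. transition x y * g y \<partial>M) \<partial>M) = (\<integral>x. (\<integral>y. transition x y * f y \<partial>M) * g x \<partial>M)"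
proof -
  have nn: "0 \<le> (\<integral>x. u x * (\<integral>y. transition x y * v y \<partial>M) \<partial>M)"
    if u: "AE x in M. 0 \<le> u x \<and> u x \<le> B" and v: "AE x in M. 0 \<le> v x \<and> v x \<le> B" for u v
  proof (rule integral_nonneg_AE)
    have "0 \<le> (\<integral>y. transition x y * v y \<partial>M)" for x
    proof (rule integral_nonneg_AE)
      show "AE y in M. 0 \<le> transition x y * v y"
        using transition_nonneg[of x] v by eventually_elim simp
    qed
    then show "AE x in M. 0 \<le> u x * (\<integral>y. transition x y * v y \<partial>M)"
      by (intro eventually_mono[OF u]) simp
  qed
  have "nn_form (\<lambda>y. ennreal (U y * g y)) (\<lambda>x. ennreal (U x * f x))
      = nn_form (\<lambda>x. ennreal (U x * f x)) (\<lambda>y. ennreal (U y * g y))" by (rule nn_form_sym) auto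
  then have "ennreal (\<integral>x. f x * (\<integral>y. transition x y * g y \<partial>M) \<partial>M) = ennreal (\<integral>x. g x * (\<integral>y. transition x y * f y \<partial>M) \<partial>M)"
    using transition_form[OF f fB g gB] transition_form[OF g gB f fB] by simp
  then show ?thesis using nn[OF fB gB] nn[OF gB fB] by (simp add: mult.commute)
qed

text \<open>For bounded \<open>f\<close> the product \<open>U * f\<close> need not be in \<open>L\<^sup>2\<close>, but it is after restricting \<open>f\<close> to a set
  where \<open>U\<close> is bounded.  Dominated convergence removes the restriction.\<close>

lemma transition_psd:
  assumes f[measurable]: "f \<in> borel_measurable M" and fB: "AE x in M. \<bar>f x\<bar> \<le> B"
  shows "0 \<le> (\<integral>x. f x * (\<integral>y. transition x y * f y \<partial>M) \<partial>M)"
proof -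
  define A where "A m = {x \<in> space M. U x \<le> real m}" for m :: nat
  have [measurable]: "A m \<in> sets M" for m unfolding A_def by measurable
  define t where "t m x = f x * indicator (A m) x" for m x
  have [measurable]: "t m \<in> borel_measurable M" for m unfolding t_def by measurable
  have tB: "AE x in M. \<bar>t m x\<bar> \<le> B" for m
    using fB by eventually_elim (auto simp: t_def indicator_def)
  have t_lim: "(\<lambda>m. t m x) \<longlonglongrightarrow> f x" if "x \<in> space M" for x
  proof (rule tendsto_eventually)
    obtain n where n: "U x \<le> real n" using real_arch_simple by blast
    show "\<forall>\<^sub>F m in sequentially. t m x = f x"
      using eventually_ge_at_top[of n]
    proof eventually_elim
      case (elim m)
      then have "U x \<le> real m" using n by simp
      then show ?case using that by (simp add: t_def A_def)
    qed
  qed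
  have pos: "0 \<le> (\<integral>x. t m x * (\<integral>y. transition x y * t m y \<partial>M) \<partial>M)" for m
  proof -
    have "integrable M (\<lambda>x. (U x * t m x)\<^sup>2)"
    proof (rule integrable_const_bound[where B="(real m * B)\<^sup>2"])
      show "AE x in M. norm ((U x * t m x)\<^sup>2) \<le> (real m * B)\<^sup>2"
        using AE_G fB
      proof eventually_elim
        case (elim x)
        show ?case
        proof (cases "x \<in> A m")
          case True
          then have "\<bar>U x * f x\<bar> \<le> real m * B"
            using elim U_pos[of x] by (auto simp: A_def abs_mult intro!: mult_mono)
          then have "\<bar>U x * f x\<bar>\<^sup>2 \<le> (real m * B)\<^sup>2" by (rule power_mono) simp
          then show ?thesis using True by (simp add: t_def)
        qed (simp add: t_def)
      qed
    qed measurable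
    then have "L2_norm M (\<lambda>x. U x * t m x) < \<infinity>" unfolding L2_norm_finite_iff by simp
    then have "0 \<le> (\<integral>x. (U x * t m x) * kernel_op M \<kappa> (\<lambda>x. U x * t m x) x \<partial>M)"
      using pos_semidef unfolding kernel_op_pos_semidef_def by blast
    also have "\<dots> = (\<integral>x. t m x * (\<integral>y. transition x y * t m y \<partial>M) \<partial>M)"
    proof (rule integral_cong_AE)
      show "AE x in M. (U x * t m x) * kernel_op M \<kappa> (\<lambda>x. U x * t m x) x = t m x * (\<integral>y. transition x y * t m y \<partial>M)"
        using AE_G by eventually_elim (simp add: transition_kernel_op)
    qed measurable
    finally show ?thesis .
  qed
  have "(\<lambda>m. \<integral>x. t m x * (\<integral>y. transition x y * t m y \<partial>M) \<partial>M) \<longlonglongrightarrow> (\<integral>x. f x * (\<integral>y. transition x y * f y \<partial>M) \<partial>M)"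
  proof (rule integral_dominated_convergence[where w="\<lambda>_. B * B"])
    show "AE x in M. (\<lambda>m. t m x * (\<integral>y. transition x y * t m y \<partial>M)) \<longlonglongrightarrow> f x * (\<integral>y. transition x y * f y \<partial>M)"
    proof (rule AE_I2)
      fix x assume x: "x \<in> space M"
      have "(\<lambda>m. \<integral>y. transition x y * t m y \<partial>M) \<longlonglongrightarrow> (\<integral>y. transition x y * f y \<partial>M)"
      proof (rule integral_dominated_convergence[where w="\<lambda>y. \<bar>transition x y * f y\<bar>"])
        show "integrable M (\<lambda>y. \<bar>transition x y * f y\<bar>)"
          by (rule integrable_abs[OF transition_times_integrable[OF f fB]])
        show "AE y in M. (\<lambda>m. transition x y * t m y) \<longlonglongrightarrow> transition x y * f y"
          by (rule AE_I2) (intro tendsto_mult_left t_lim)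
        show "AE y in M. norm (transition x y * t m y) \<le> \<bar>transition x y * f y\<bar>" for m
          by (auto simp: t_def indicator_def)
      qed (use borel_measurable_integrable[OF transition_integrable[of x]] in measurable)
      then show "(\<lambda>m. t m x * (\<integral>y. transition x y * t m y \<partial>M)) \<longlonglongrightarrow> f x * (\<integral>y. transition x y * f y \<partial>M)"
        by (intro tendsto_mult t_lim x)
    qed
    show "AE x in M. norm (t m x * (\<integral>y. transition x y * t m y \<partial>M)) \<le> B * B" for m
      using tB[of m]
    proof eventually_elim
      case (elim x)
      have "\<bar>\<integral>y. transition x y * t m y \<partial>M\<bar> \<le> B" by (rule transition_abs_le[OF _ tB]) measurable
      with elim show ?case by (auto simp: abs_mult intro!: mult_mono order_trans[OF abs_ge_zero])
    qed
  qed auto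
  then show ?thesis by (rule LIMSEQ_le_const) (use pos in auto)
qed

lemma transition_cross_ratio:
  assumes z: "z \<in> G" and w: "w \<in> G"
  shows "AE x in M. AE y in M. transition z x * transition w y \<le> exp D * (transition w x * transition z y)"
  using AE_G
proof eventually_elim
  case (elim x)
  show ?case using AE_G
  proof eventually_elim
    case (elim y)
    have "(U z * U x * U w * U y) * (\<kappa> z x * \<kappa> w y) \<le> (U z * U x * U w * U y) * (exp D * (\<kappa> w x * \<kappa> z y))"
      using kernel_cross_ratio[OF z w \<open>x \<in> G\<close> elim] U_pos[OF z] U_pos[OF w] U_pos[OF \<open>x \<in> G\<close>] U_pos[OF elim]
      by (intro mult_left_mono) auto
    then show ?case using z w by (simp add: transition_def mult_ac)
  qed
qed

lemma contracting_markov: "contracting_markov M transition D G"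
  by unfold_locales
    (fact transition_measurable transition_integrable transition_nonneg transition_total
      transition_symmetric transition_psd D_nonneg AE_G transition_cross_ratio)+

end

sublocale sinkhorn_problem \<subseteq> contracting_markov M transition D G by (rule contracting_markov)

section \<open>Convergence of the iteration\<close>

context contracting_markov
begin

lemma bdd_funpow_accel[simp]: "bdd f \<Longrightarrow> bdd ((accel_log_step ^^ n) f)"
  by (induction n) auto

lemma funpow_accel_abs_le:
  assumes "bdd f" "AE x in M. \<bar>f x\<bar> \<le> B" shows "AE x in M. \<bar>(accel_log_step ^^ n) f x\<bar> \<le> B"
proof (induction n)
  case (Suc n)
  from accel_abs_le[OF bdd_funpow_accel[OF assms(1)] this] show ?case by simp
qed (use assms in simp)

text \<open>The oscillation contracts at every step.  The factor 2 compares the initial oscillation with the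
  initial sup norm; going back, after at least one step, costs nothing by \<open>accel_abs_le_osc\<close>.\<close>

lemma funpow_accel_global:
  assumes nz: "emeasure M (space M) \<noteq> 0" and f: "bdd f" and B: "AE x in M. \<bar>f x\<bar> \<le> B" "0 \<le> B"
  shows "AE x in M. \<bar>(accel_log_step ^^ n) f x\<bar> \<le> 2 * (tanh (D/4) * ((1 + tanh (D/4)) / 2)) ^ n * B"
proof -
  define q where "q = tanh (D/4) * ((1 + tanh (D/4)) / 2)"
  have q: "q \<ge> 0" using D_nonneg by (simp add: q_def)
  have osc: "osc_le ((accel_log_step ^^ n) f) (q ^ n * (2 * B))" for n
  proof (induction n)
    case 0
    have "AE x in M. - B \<le> f x \<and> f x \<le> - B + 2 * B" using B(1) by eventually_elim auto
    then show ?case unfolding osc_le_def by auto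
  next
    case (Suc n)
    have "osc_le (accel_log_step ((accel_log_step ^^ n) f)) (q * (q ^ n * (2 * B)))"
      using osc_le_accel[OF bdd_funpow_accel[OF f] Suc] B q unfolding q_def[symmetric] by simp
    then show ?case by (simp add: mult.assoc)
  qed
  show ?thesis
  proof (cases n)
    case 0
    then show ?thesis using B(2) by (intro eventually_mono[OF B(1)]) simp
  next
    case (Suc m)
    have "AE x in M. \<bar>accel_log_step ((accel_log_step ^^ m) f) x\<bar> \<le> q ^ n * (2 * B)"
      using osc[of n] Suc f by (intro accel_abs_le_osc nz) auto
    then show ?thesis using Suc by (simp add: q_def mult_ac)
  qed
qed

lemma funpow_accel_local:
  assumes f: "bdd f" and k: "AE x in M. \<bar>f x\<bar> \<le> k" "0 \<le> k"
    and r: "r = 1/8 + k * exp (4 * k) * (2 + 1/2 * k * exp (4 * k))"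
  shows "nrm ((accel_log_step ^^ Suc n) f) \<le> r * nrm ((accel_log_step ^^ n) f)" "nrm ((accel_log_step ^^ n) f) \<le> r ^ n * nrm f"
proof -
  show step: "nrm ((accel_log_step ^^ Suc n) f) \<le> r * nrm ((accel_log_step ^^ n) f)" for n
    unfolding r using accel_local_contraction[OF bdd_funpow_accel[OF f] funpow_accel_abs_le[OF f k(1)] k(2)] by simp
  have "r \<ge> 0" using k by (simp add: r)
  show "nrm ((accel_log_step ^^ n) f) \<le> r ^ n * nrm f"
  proof (induction n)
    case (Suc n)
    show ?case using order_trans[OF step mult_left_mono[OF Suc \<open>r \<ge> 0\<close>]] by (simp add: mult.assoc)
  qed simp
qed

end

lemma accel_sinkhorn_measurable:
  assumes M: "sigma_finite_measure M"
    and [measurable]: "(\<lambda>(x, y). \<kappa> x y) \<in> borel_measurable (M \<Otimes>\<^sub>M M)" "V \<in> borel_measurable M"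
  shows "accel_sinkhorn M \<kappa> V n \<in> borel_measurable M"
proof -
  interpret sigma_finite_measure M by fact
  have step: "sinkhorn_step M \<kappa> W \<in> borel_measurable M" if [measurable]: "W \<in> borel_measurable M" for W
    unfolding sinkhorn_step_def kernel_op_def by measurable
  show ?thesis
  proof (induction n)
    case (Suc n)
    note [measurable] = step[OF Suc] step[OF step[OF Suc]]
    show ?case by (simp add: Let_def)
  qed simp
qed

lemma log_diff_measurable:
  assumes [measurable]: "V \<in> borel_measurable M" "W \<in> borel_measurable M"
  shows "log_diff V W \<in> borel_measurable M"
  unfolding log_diff_def by measurable

lemma Linf_norm_leI:
  assumes "f \<in> borel_measurable M" "AE x in M. \<bar>f x\<bar> \<le> B"
  shows "Linf_norm M f \<le> ennreal B"
  unfolding Linf_norm_def using assms by (auto intro!: esssup_I ennreal_leI)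

lemma AE_le_of_Linf_norm:
  assumes "Linf_norm M f \<le> ennreal B" "0 \<le> B"
  shows "AE x in M. \<bar>f x\<bar> \<le> B"
proof -
  have f: "f \<in> borel_measurable M" "esssup M (\<lambda>x. ennreal \<bar>f x\<bar>) \<le> ennreal B"
    using assms(1) by (auto simp: Linf_norm_def top_unique split: if_splits)
  have "AE x in M. ennreal \<bar>f x\<bar> \<le> esssup M (\<lambda>x. ennreal \<bar>f x\<bar>)" by (rule esssup_AE)
  then show ?thesis
    by eventually_elim (use f(2) assms(2) in \<open>metis ennreal_le_iff order_trans\<close>)
qed

context sinkhorn_problem
begin

lemma log_step_cong_AE: "bdd f \<Longrightarrow> bdd g \<Longrightarrow> AE x in M. f x = g x \<Longrightarrow> log_step f = log_step g"
  unfolding log_step_def using P_cong_AE[of "\<lambda>y. exp (f y)" "\<lambda>y. exp (g y)"] by auto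

lemma accel_cong_AE: "bdd f \<Longrightarrow> bdd g \<Longrightarrow> AE x in M. f x = g x \<Longrightarrow> accel_log_step f = accel_log_step g"
  unfolding accel_log_step_def using log_step_cong_AE[of f g] by simp

lemma bdd_cong_AE:
  assumes "bdd g" "f \<in> borel_measurable M" "AE x in M. f x = g x" shows "bdd f"
proof -
  obtain B where "AE x in M. \<bar>g x\<bar> \<le> B" using assms by (auto simp: bdd_def)
  with assms(3) have "AE x in M. \<bar>f x\<bar> \<le> B" by eventually_elim simp
  then show ?thesis by (rule bddI[OF assms(2)])
qed

lemma sinkhorn_step_measurable[measurable]:
  assumes [measurable]: "V \<in> borel_measurable M" shows "sinkhorn_step M \<kappa> V \<in> borel_measurable M"
  unfolding sinkhorn_step_def by measurable

text \<open>Intertwines the Sinkhorn step with \<open>log_step\<close>: \<open>P (V / U) = U * K[V]\<close>.\<close>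

lemma sinkhorn_step_log:
  assumes V[measurable]: "V \<in> borel_measurable M" and V0: "AE x in M. 0 < V x" and f: "bdd (log_diff V U)"
    and x: "x \<in> G"
  shows "0 < sinkhorn_step M \<kappa> V x" "log_diff (sinkhorn_step M \<kappa> V) U x = log_step (log_diff V U) x"
proof -
  note [measurable] = kernel_section_measurable[OF x]
  let ?g = "\<lambda>y. exp (log_diff V U y)"
  have [measurable]: "log_diff V U \<in> borel_measurable M" by (rule log_diff_measurable) measurable
  have "kernel_op M \<kappa> (\<lambda>y. U y * ?g y) x = kernel_op M \<kappa> V x"
    unfolding kernel_op_def
  proof (rule integral_cong_AE)
    show "AE y in M. \<kappa> x y * (U y * ?g y) = \<kappa> x y * V y"
      using AE_G V0
    proof eventually_elim
      case (elim y)
      then show ?case using U_pos[OF elim(1)] by (simp add: log_diff_def exp_diff)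
    qed
  qed measurable
  then have P: "P ?g x = U x * kernel_op M \<kappa> V x" unfolding P_def by (simp add: transition_kernel_op[OF x])
  then have K: "kernel_op M \<kappa> V x > 0" using P_exp_pos[OF f, of x] U_pos[OF x] by (simp add: zero_less_mult_iff)
  then show "0 < sinkhorn_step M \<kappa> V x" by (simp add: sinkhorn_step_def)
  show "log_diff (sinkhorn_step M \<kappa> V) U x = log_step (log_diff V U) x"
    using K U_pos[OF x] unfolding log_step_def P by (simp add: log_diff_def sinkhorn_step_def ln_mult_pos ln_div)
qed

lemma accelerated_step_log:
  assumes V[measurable]: "V \<in> borel_measurable M" and V0: "AE x in M. 0 < V x" and f: "bdd (log_diff V U)"
  defines "W \<equiv> \<lambda>x. sqrt (sinkhorn_step M \<kappa> V x * sinkhorn_step M \<kappa> (sinkhorn_step M \<kappa> V) x)"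
  shows "AE x in M. 0 < W x" "AE x in M. log_diff W U x = accel_log_step (log_diff V U) x"
proof -
  let ?Va = "sinkhorn_step M \<kappa> V"
  have a: "\<And>x. x \<in> G \<Longrightarrow> 0 < ?Va x \<and> log_diff ?Va U x = log_step (log_diff V U) x"
    using sinkhorn_step_log[OF V V0 f] by blast
  have AE_a: "AE x in M. 0 < ?Va x" "AE x in M. log_diff ?Va U x = log_step (log_diff V U) x"
    using AE_G by (eventually_elim, simp add: a)+
  have bdd_a: "bdd (log_diff ?Va U)"
    using f by (intro bdd_cong_AE[OF _ _ AE_a(2)] log_diff_measurable) auto
  have "log_step (log_diff ?Va U) = log_step (log_step (log_diff V U))" using f by (intro log_step_cong_AE AE_a bdd_a) auto
  then have b: "\<And>x. x \<in> G \<Longrightarrow> 0 < sinkhorn_step M \<kappa> ?Va x \<and> log_diff (sinkhorn_step M \<kappa> ?Va) U x = log_step (log_step (log_diff V U)) x"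
    using sinkhorn_step_log[OF _ AE_a(1) bdd_a] by simp
  show "AE x in M. 0 < W x" using AE_G by eventually_elim (simp add: W_def a b)
  show "AE x in M. log_diff W U x = accel_log_step (log_diff V U) x"
    using AE_G
  proof eventually_elim
    case (elim x)
    have "ln (W x) = (ln (?Va x) + ln (sinkhorn_step M \<kappa> ?Va x)) / 2"
      using a[OF elim] b[OF elim] by (simp add: W_def ln_sqrt ln_mult_pos)
    then show ?case using a[OF elim] b[OF elim] unfolding log_diff_def accel_log_step_def by (simp add: field_simps)
  qed
qed

lemma accel_sinkhorn_log:
  assumes V[measurable]: "V \<in> borel_measurable M" and V0: "AE x in M. 0 < V x" and f: "bdd (log_diff V U)"
  shows "AE x in M. 0 < accel_sinkhorn M \<kappa> V n x"
    "AE x in M. log_diff (accel_sinkhorn M \<kappa> V n) U x = (accel_log_step ^^ n) (log_diff V U) x"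
proof (induction n)
  case (Suc n)
  let ?V = "accel_sinkhorn M \<kappa> V n"
  have V': "?V \<in> borel_measurable M"
    using V by (rule accel_sinkhorn_measurable[OF sigma_finite_measure_axioms kernel_measurable])
  have bdd: "bdd (log_diff ?V U)"
    using f V' by (intro bdd_cong_AE[OF _ _ Suc(2)] log_diff_measurable) auto
  have eq: "accel_log_step (log_diff ?V U) = accel_log_step ((accel_log_step ^^ n) (log_diff V U))"
    using f by (intro accel_cong_AE bdd Suc) auto
  case 1 show ?case using accelerated_step_log(1)[OF V' Suc(1) bdd] by (simp add: Let_def)
  case 2 show ?case using accelerated_step_log(2)[OF V' Suc(1) bdd] unfolding eq by (simp add: Let_def)
qed (use V0 in auto)

text \<open>For \<open>D = 0\<close> the rows of the kernel are proportional, so \<open>K[V]\<close> is a multiple of \<open>K[U]\<close> whatever \<open>V\<close>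
  is, as long as the integrals converge.  Thus \<open>1 / K[V] = U / t\<close> for a constant \<open>t\<close>, the next Sinkhorn
  step gives \<open>t * U\<close>, and their geometric mean is \<open>U\<close>.\<close>

lemma rank_one_converges_in_one_step:
  assumes D: "D = 0" and V[measurable]: "V \<in> borel_measurable M" and V0: "AE x in M. 0 < V x"
    and def: "kernel_op_defined M \<kappa> V"
  shows "AE x in M. 0 < accel_sinkhorn M \<kappa> V (Suc n) x \<and> log_diff (accel_sinkhorn M \<kappa> V (Suc n)) U x = 0"
proof (induction n)
  case 0
  have "\<exists>w. w \<in> G \<and> integrable M (\<lambda>y. \<kappa> w y * V y)"
  proof (rule ccontr)
    assume "\<not> ?thesis"
    then have "AE x in M. False"
      using AE_G def[unfolded kernel_op_defined_def] by (auto elim: eventually_elim2)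
    then show False using nonzero by (simp add: AE_iff_measurable[of "space M"])
  qed
  then obtain w where w: "w \<in> G" and int: "integrable M (\<lambda>y. \<kappa> w y * V y)" by blast
  define t where "t = U w * kernel_op M \<kappa> V w"
  have "kernel_op M \<kappa> V w \<noteq> 0"
  proof
    have nn: "AE y in M. 0 < \<kappa> w y * V y" using AE_G V0 by eventually_elim (simp add: kernel_pos[OF w])
    assume "kernel_op M \<kappa> V w = 0"
    moreover have "AE y in M. 0 \<le> \<kappa> w y * V y" using nn by eventually_elim simp
    ultimately have "AE y in M. \<kappa> w y * V y = 0"
      using integral_nonneg_eq_0_iff_AE[OF int] unfolding kernel_op_def by blast
    with nn have "AE y in M. False" by eventually_elim simp
    then show False using nonzero by (simp add: AE_iff_measurable[of "space M"])
  qed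
  moreover have "0 \<le> kernel_op M \<kappa> V w"
    unfolding kernel_op_def
  proof (rule integral_nonneg_AE)
    show "AE y in M. 0 \<le> \<kappa> w y * V y" using AE_G V0 by eventually_elim (simp add: kernel_pos[OF w] less_imp_le)
  qed
  ultimately have t: "t > 0" using U_pos[OF w] by (simp add: t_def)
  have Va: "sinkhorn_step M \<kappa> V z = U z / t" if z: "z \<in> G" for z
  proof -
    define a where "a = \<kappa> z w / \<kappa> w w"
    have "\<kappa> z y = a * \<kappa> w y" if y: "y \<in> G" for y
      using kernel_cross_ratio[OF z w y w] kernel_cross_ratio[OF w z y w] kernel_pos[OF w w]
      by (simp add: D a_def field_simps)
    then have K: "kernel_op M \<kappa> h z = a * kernel_op M \<kappa> h w" if [measurable]: "h \<in> borel_measurable M" for h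
      unfolding kernel_op_def integral_mult_right_zero[symmetric]
      using kernel_section_measurable[OF z] kernel_section_measurable[OF w] AE_G
      by (intro integral_cong_AE) (auto elim: eventually_mono)
    have "a > 0" using kernel_pos w z by (simp add: a_def)
    have "U z * (a * kernel_op M \<kappa> U w) = 1" using U_solves[OF z] K[OF U_measurable] by simp
    then have "U z * a = U w" using U_solves[OF w] U_pos[OF w] by (metis mult.assoc mult.commute mult_cancel_right1 mult_cancel_left)
    then show ?thesis using U_pos[OF z] unfolding sinkhorn_step_def t_def K[OF V] by (auto simp flip: \<open>U z * a = U w\<close>)
  qed
  let ?Va = "sinkhorn_step M \<kappa> V"
  have AE_a: "AE x in M. 0 < ?Va x" "AE x in M. log_diff ?Va U x = - ln t"
    using AE_G by (eventually_elim, simp add: Va U_pos t log_diff_def ln_div less_imp_neq[OF t, symmetric] less_imp_neq[OF U_pos, symmetric])+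
  have bdd_a: "bdd (log_diff ?Va U)"
    by (intro bdd_cong_AE[OF _ _ AE_a(2)] log_diff_measurable) auto
  have Sa: "log_step (log_diff ?Va U) = (\<lambda>_. ln t)"
    using log_step_cong_AE[OF bdd_a bdd_const AE_a(2)] t by (simp add: log_step_def[abs_def] P_const)
  show ?case
    using AE_G
  proof eventually_elim
    case (elim x)
    have b: "0 < sinkhorn_step M \<kappa> ?Va x" "log_diff (sinkhorn_step M \<kappa> ?Va) U x = ln t"
      using sinkhorn_step_log[OF _ AE_a(1) bdd_a elim] Sa by auto
    have a: "0 < ?Va x" using Va[OF elim] U_pos[OF elim] t by simp
    have "ln (sqrt (?Va x * sinkhorn_step M \<kappa> ?Va x)) = (ln (?Va x) + ln (sinkhorn_step M \<kappa> ?Va x)) / 2"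
      using a b(1) by (simp add: ln_sqrt ln_mult_pos)
    also have "ln (?Va x) = ln (U x) - ln t" using Va[OF elim] U_pos[OF elim] t by (simp add: ln_divide_pos)
    finally show ?case using a b by (simp add: Let_def log_diff_def)
  qed
next
  case (Suc n)
  let ?V = "accel_sinkhorn M \<kappa> V (Suc n)"
  have V': "?V \<in> borel_measurable M"
    using V by (rule accel_sinkhorn_measurable[OF sigma_finite_measure_axioms kernel_measurable])
  have pos: "AE x in M. 0 < ?V x" and zero: "AE x in M. \<bar>log_diff ?V U x\<bar> \<le> 0"
    using Suc by (eventually_elim, simp)+
  have bdd: "bdd (log_diff ?V U)" using log_diff_measurable[OF V' U_measurable] zero by (rule bddI)
  have "AE x in M. accel_log_step (log_diff ?V U) x = 0" using accel_abs_le[OF bdd zero] by simp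
  with accelerated_step_log[OF V' pos bdd] show ?case
    by eventually_elim (simp add: Let_def)
qed

lemma L2_norm_eq_nrm:
  assumes f: "f \<in> borel_measurable M" and g: "bdd g" and eq: "AE x in M. f x = g x"
  shows "L2_norm M f = ennreal (nrm g)"
proof -
  have bf: "bdd f" by (rule bdd_cong_AE[OF g f eq])
  have "(\<integral>x. (f x)\<^sup>2 \<partial>M) = ip g g"
    unfolding ip_def using f g eq by (intro integral_cong_AE) (auto simp: power2_eq_square bdd_def elim!: eventually_mono)
  moreover have "integrable M (\<lambda>x. (f x)\<^sup>2)" using bf by (simp add: power2_eq_square)
  ultimately show ?thesis using f by (simp add: L2_norm_def nrm_def)
qed

end

context sinkhorn_problem
begin

text \<open>If the initial distance is infinite and the rate is 0, the right-hand side is \<open>0 * \<infinity> = 0\<close> for \<open>n > 0\<close>;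
  this is the case covered by \<open>rank_one_converges_in_one_step\<close>.\<close>

lemma global_convergence:
  assumes V[measurable]: "V \<in> borel_measurable M" and V0: "AE x in M. 0 < V x" and def: "kernel_op_defined M \<kappa> V"
  shows "Linf_norm M (log_diff (accel_sinkhorn M \<kappa> V n) U)
    \<le> ennreal (2 * (tanh (D/4) * ((1 + tanh (D/4)) / 2)) ^ n) * Linf_norm M (log_diff V U)"
proof -
  define q where "q = tanh (D/4) * ((1 + tanh (D/4)) / 2)"
  have q: "q \<ge> 0" using D_nonneg by (simp add: q_def)
  have meas: "log_diff (accel_sinkhorn M \<kappa> V n) U \<in> borel_measurable M"
    by (intro log_diff_measurable U_measurable
      accel_sinkhorn_measurable[OF sigma_finite_measure_axioms kernel_measurable V])
  consider (fin) "Linf_norm M (log_diff V U) \<noteq> \<infinity>" | (pos) "Linf_norm M (log_diff V U) = \<infinity>" "q > 0 \<or> n = 0"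
    | (zero) m where "Linf_norm M (log_diff V U) = \<infinity>" "q = 0" "n = Suc m"
    using q by (cases n) fastforce+
  then show ?thesis
  proof cases
    case fin
    then obtain B where B: "Linf_norm M (log_diff V U) = ennreal B" "0 \<le> B"
      by (metis ennreal_cases infinity_ennreal_def)
    have AE: "AE x in M. \<bar>log_diff V U x\<bar> \<le> B" using AE_le_of_Linf_norm[of M _ B] B by simp
    have f: "bdd (log_diff V U)" by (rule bddI[OF log_diff_measurable[OF V U_measurable] AE])
    have "AE x in M. \<bar>log_diff (accel_sinkhorn M \<kappa> V n) U x\<bar> \<le> 2 * q ^ n * B"
      using accel_sinkhorn_log(2)[OF V V0 f, of n] funpow_accel_global[OF nonzero f AE B(2), of n]
      unfolding q_def by eventually_elim simp
    from Linf_norm_leI[OF meas this] show ?thesis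
      unfolding q_def[symmetric] using q B by (simp add: ennreal_mult)
  next
    case pos
    then have "ennreal (2 * q ^ n) \<noteq> 0" by auto
    then show ?thesis unfolding q_def[symmetric] pos(1) infinity_ennreal_def by (simp add: ennreal_mult_top)
  next
    case zero
    have "tanh (D/4) \<ge> 0" using D_nonneg by simp
    then have "tanh (D/4) = 0" using zero(2) by (simp add: q_def add_nonneg_eq_0_iff)
    then have "D = 0" by simp
    have "AE x in M. \<bar>log_diff (accel_sinkhorn M \<kappa> V n) U x\<bar> \<le> 0"
      using rank_one_converges_in_one_step[OF \<open>D = 0\<close> V V0 def, of m] unfolding zero(3)
      by eventually_elim simp
    from Linf_norm_leI[OF meas this] show ?thesis by simp
  qed
qed

text \<open>For the second claim, \<open>nrm (F n) \<le> r * nrm (F (n - 1))\<close> and the triangle inequality give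
  \<open>(1 / r - 1) * nrm (F n) \<le> nrm (F n - F (n - 1))\<close>.\<close>

lemma local_convergence:
  assumes V[measurable]: "V \<in> borel_measurable M" and V0: "AE x in M. 0 < V x"
    and k: "0 \<le> k" "Linf_norm M (log_diff V U) \<le> ennreal k"
    and r: "r = 1 / 8 + k * exp (4 * k) * (2 + 1 / 2 * k * exp (4 * k))"
  shows "L2_norm M (log_diff (accel_sinkhorn M \<kappa> V n) U) \<le> ennreal (r ^ n) * L2_norm M (log_diff V U)"
    and "r < 1 / 2 \<Longrightarrow> 1 \<le> n \<Longrightarrow> L2_norm M (log_diff (accel_sinkhorn M \<kappa> V n) U)
      \<le> ennreal (inverse (inverse r - 1)) * L2_norm M (log_diff (accel_sinkhorn M \<kappa> V n) (accel_sinkhorn M \<kappa> V (n - 1)))"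
proof -
  have AE: "AE x in M. \<bar>log_diff V U x\<bar> \<le> k" by (rule AE_le_of_Linf_norm[OF k(2,1)])
  have f: "bdd (log_diff V U)" by (rule bddI[OF log_diff_measurable[OF V U_measurable] AE])
  define F where "F n = (accel_log_step ^^ n) (log_diff V U)" for n
  have F: "bdd (F n)" for n using f by (simp add: F_def)
  have meas: "accel_sinkhorn M \<kappa> V n \<in> borel_measurable M" for n
    by (rule accel_sinkhorn_measurable[OF sigma_finite_measure_axioms kernel_measurable V])
  have log: "AE x in M. log_diff (accel_sinkhorn M \<kappa> V n) U x = F n x" for n
    unfolding F_def by (rule accel_sinkhorn_log(2)[OF V V0 f])
  have L2: "L2_norm M (log_diff (accel_sinkhorn M \<kappa> V n) U) = ennreal (nrm (F n))" for n
    by (rule L2_norm_eq_nrm[OF log_diff_measurable[OF meas U_measurable] F log])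
  have L2_0: "L2_norm M (log_diff V U) = ennreal (nrm (F 0))" using L2[of 0] by simp
  have r_pos: "r > 0" using k(1) by (simp add: r add_pos_nonneg)
  have contr: "nrm (F (Suc n)) \<le> r * nrm (F n)" "nrm (F n) \<le> r ^ n * nrm (F 0)" for n
    using funpow_accel_local[OF f AE k(1) r, of n] by (simp_all add: F_def)
  show "L2_norm M (log_diff (accel_sinkhorn M \<kappa> V n) U) \<le> ennreal (r ^ n) * L2_norm M (log_diff V U)"
    unfolding L2 L2_0 using contr(2)[of n] r_pos by (simp add: ennreal_leI flip: ennreal_mult)
  show "L2_norm M (log_diff (accel_sinkhorn M \<kappa> V n) U)
      \<le> ennreal (inverse (inverse r - 1)) * L2_norm M (log_diff (accel_sinkhorn M \<kappa> V n) (accel_sinkhorn M \<kappa> V (n - 1)))"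
    if r_less: "r < 1 / 2" and n_ge: "1 \<le> n"
  proof -
    obtain m where n: "n = Suc m" using n_ge by (cases n) auto
    have "L2_norm M (log_diff (accel_sinkhorn M \<kappa> V n) (accel_sinkhorn M \<kappa> V m)) = ennreal (nrm (\<lambda>x. F n x - F m x))"
    proof (rule L2_norm_eq_nrm[OF log_diff_measurable[OF meas meas]])
      show "AE x in M. log_diff (accel_sinkhorn M \<kappa> V n) (accel_sinkhorn M \<kappa> V m) x = F n x - F m x"
        using log[of n] log[of m] by eventually_elim (simp add: log_diff_def)
    qed (use F in simp)
    moreover have "nrm (F n) \<le> inverse (inverse r - 1) * nrm (\<lambda>x. F n x - F m x)"
    proof -
      have "nrm (F m) \<le> nrm (F n) + nrm (\<lambda>x. F n x - F m x)"
        using nrm_triangle_diff[OF F[of n] bdd_diff[OF F[of n] F[of m]]] by simp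
      moreover have "inverse r * nrm (F n) \<le> nrm (F m)"
        using contr(1)[of m] r_pos by (simp add: n field_simps)
      ultimately have "(inverse r - 1) * nrm (F n) \<le> nrm (\<lambda>x. F n x - F m x)" by (simp add: algebra_simps)
      moreover have "inverse r - 1 > 0" using r_pos r_less by (simp add: field_simps)
      ultimately show ?thesis by (simp add: field_simps)
    qed
    moreover have "0 \<le> inverse (inverse r - 1)" using r_pos r_less by (simp add: field_simps)
    ultimately show ?thesis unfolding L2 using n by (simp add: ennreal_leI flip: ennreal_mult)
  qed
qed

end

lemma norms_null_measure:
  assumes "emeasure M (space M) = 0" "f \<in> borel_measurable M"
  shows "Linf_norm M f = 0" "L2_norm M f = 0"
proof -
  have AE: "AE x in M. P x" for P
    using assms(1) by (intro AE_I'[of "space M"]) (auto simp: null_sets_def)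
  show "Linf_norm M f = 0" using Linf_norm_leI[OF assms(2) AE, of 0] by simp
  have "(\<integral>x. (f x)\<^sup>2 \<partial>M) = 0" by (rule integral_eq_zero_AE[OF AE])
  moreover have "integrable M (\<lambda>x. (f x)\<^sup>2)"
    using assms(2) by (intro integrable_cong_AE_imp[OF integrable_zero _ AE]) simp
  ultimately show "L2_norm M f = 0" using assms(2) by (simp add: L2_norm_def)
qed

theorem theorem4p1:
  fixes M :: "'a::second_countable_topology measure"
    and \<kappa> :: "'a \<Rightarrow> 'a \<Rightarrow> real"
    and U U0 :: "'a \<Rightarrow> real"
  assumes borel: "sets M = sets borel"
    and kernel_measurable: "(\<lambda>(x, y). \<kappa> x y) \<in> borel_measurable (M \<Otimes>\<^sub>M M)"
    and kernel_pos: "\<And>x y. x \<in> measure_support M \<Longrightarrow> y \<in> measure_support M \<Longrightarrow> 0 < \<kappa> x y"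
    and bounded_L2: "kernel_op_bounded M (L2_norm M) \<kappa>"
    and pos_semidef: "kernel_op_pos_semidef M \<kappa>"
    and self_adjoint: "kernel_op_self_adjoint M \<kappa>"
    and bounded_Linf: "kernel_op_bounded M (Linf_norm M) \<kappa>"
    and contraction: "contraction_rate M \<kappa> < 1"
    and U_measurable: "U \<in> borel_measurable M"
    and U_pos: "AE x in M. 0 < U x"
    and U_solves: "AE x in M. U x * kernel_op M \<kappa> U x = 1"
    and U0_measurable: "U0 \<in> borel_measurable M"
    and U0_pos: "AE x in M. 0 < U0 x"
    and U0_defined: "kernel_op_defined M \<kappa> U0"
  shows
    "(\<forall>n. Linf_norm M (log_diff (accel_sinkhorn M \<kappa> U0 n) U)
        \<le> ennreal (2 * (contraction_rate M \<kappa> * ((1 + contraction_rate M \<kappa>) / 2)) ^ n)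
           * Linf_norm M (log_diff U0 U))
   \<and> (\<forall>k k'' :: real.
        0 \<le> k \<and> Linf_norm M (log_diff U0 U) \<le> ennreal k \<and> k < 1 / 10
        \<and> k'' = k * exp (4 * k) * (2 + 1 / 2 * k * exp (4 * k)) \<and> k'' < 3 / 8 \<longrightarrow>
        (\<forall>n. L2_norm M (log_diff (accel_sinkhorn M \<kappa> U0 n) U)
            \<le> ennreal ((1 / 8 + k'') ^ n) * L2_norm M (log_diff U0 U))
      \<and> (\<forall>n\<ge>1. L2_norm M (log_diff (accel_sinkhorn M \<kappa> U0 n) U)
            \<le> ennreal (inverse (inverse (1 / 8 + k'') - 1))
               * L2_norm M (log_diff (accel_sinkhorn M \<kappa> U0 n)
                                     (accel_sinkhorn M \<kappa> U0 (n - 1)))))"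
proof (cases "emeasure M (space M) = 0")
  case True
  \<comment> \<open>for the zero measure the support is empty and the rate is \<open>-1\<close>, but all norms vanish\<close>
  have "finite_measure M" using True by (intro finite_measureI) simp
  then have sf: "sigma_finite_measure M" by (simp add: finite_measure_def)
  have meas: "accel_sinkhorn M \<kappa> U0 n \<in> borel_measurable M" for n
    by (rule accel_sinkhorn_measurable[OF sf kernel_measurable U0_measurable])
  show ?thesis
    using norms_null_measure[OF True log_diff_measurable[OF meas U_measurable]]
    by simp
next
  case False
  have "AE x in M. x \<in> measure_support M \<and> 0 < U x \<and> U x * kernel_op M \<kappa> U x = 1"
    using AE_measure_support[OF borel] U_pos U_solves by eventually_elim simp
  then obtain N where N: "{x \<in> space M. \<not> (x \<in> measure_support M \<and> 0 < U x \<and> U x * kernel_op M \<kappa> U x = 1)} \<subseteq> N"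
      "emeasure M N = 0" "N \<in> sets M"
    by (rule AE_E)
  \<comment> \<open>complement of a measurable null set, since the set of good points itself is not known to be measurable\<close>
  define G where "G = space M - N"
  have G: "x \<in> measure_support M" "0 < U x" "U x * kernel_op M \<kappa> U x = 1" if "x \<in> G" for x
    using that N(1) by (auto simp: G_def)
  have AE_G: "AE x in M. x \<in> G"
    using N by (intro AE_I'[of N]) (auto simp: G_def null_sets_def)
  have "measure_support M \<noteq> {}"
  proof
    assume "measure_support M = {}"
    then have "AE x in M. False" using AE_measure_support[OF borel] by simp
    then show False using False by (simp add: AE_iff_measurable[of "space M"])
  qed
  then obtain D where D: "0 \<le> D" "contraction_rate M \<kappa> = tanh (D / 4)"
    "\<And>z w x y. z \<in> measure_support M \<Longrightarrow> w \<in> measure_support M \<Longrightarrow> x \<in> measure_support M \<Longrightarrow>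
       y \<in> measure_support M \<Longrightarrow> \<kappa> z x * \<kappa> w y \<le> exp D * (\<kappa> w x * \<kappa> z y)"
    using contraction_rate_diameter[OF _ kernel_pos contraction] by metis
  have G_sets: "G \<in> sets M" using N(3) by (simp add: G_def)
  interpret sinkhorn_problem M \<kappa> U D G
    by unfold_locales (fact False kernel_measurable G_sets AE_G bounded_L2 pos_semidef self_adjoint
      U_measurable D(1) G(2) G(3) | simp add: kernel_pos D(3) G(1))+
  show ?thesis
  proof (intro conjI allI impI)
    fix n
    show "Linf_norm M (log_diff (accel_sinkhorn M \<kappa> U0 n) U)
        \<le> ennreal (2 * (contraction_rate M \<kappa> * ((1 + contraction_rate M \<kappa>) / 2)) ^ n)
           * Linf_norm M (log_diff U0 U)"
      unfolding D(2) by (rule global_convergence[OF U0_measurable U0_pos U0_defined])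
  next
    fix k k'' :: real and n
    assume "0 \<le> k \<and> Linf_norm M (log_diff U0 U) \<le> ennreal k \<and> k < 1 / 10
        \<and> k'' = k * exp (4 * k) * (2 + 1 / 2 * k * exp (4 * k)) \<and> k'' < 3 / 8"
    then have k: "0 \<le> k" "Linf_norm M (log_diff U0 U) \<le> ennreal k"
      and r: "1 / 8 + k'' = 1 / 8 + k * exp (4 * k) * (2 + 1 / 2 * k * exp (4 * k))" "1 / 8 + k'' < 1 / 2"
      by auto
    show "L2_norm M (log_diff (accel_sinkhorn M \<kappa> U0 n) U)
            \<le> ennreal ((1 / 8 + k'') ^ n) * L2_norm M (log_diff U0 U)"
      by (rule local_convergence(1)[OF U0_measurable U0_pos k r(1)])
    show "L2_norm M (log_diff (accel_sinkhorn M \<kappa> U0 n) U)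
            \<le> ennreal (inverse (inverse (1 / 8 + k'') - 1))
               * L2_norm M (log_diff (accel_sinkhorn M \<kappa> U0 n) (accel_sinkhorn M \<kappa> U0 (n - 1)))"
      if "1 \<le> n"
      by (rule local_convergence(2)[OF U0_measurable U0_pos k r that])
  qed
qed

end
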